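(* Let $n\ge 2$. The central series $\{Z^{(\lambda)}(\mathfrak{u}_n)\}_\lambda$ ($\lambda$ ranging over all ordinals) stabilizes precisely at step $\omega^{n-1}+\omega^{n-2}+\cdots+\omega+1$, i.e. $\mathrm{c.dim}(\mathfrak{u}_n)=\omega^{n-1}+\omega^{n-2}+\cdots+\omega+1$. Moreover, $Z^{(\lambda)}(\mathfrak{u}_n)=I_\lambda$ for each $\lambda\in[1,\omega^{n-1}+\omega^{n-2}+\cdots+\omega+1]$. In particular, $Z^{(\mathrm{c.dim}(\mathfrak{u}_n))}(\mathfrak{u}_n)=\mathfrak{u}_n$.
   Context: $K$ is a field of characteristic zero, $\mathbb{N}=\{0,1,\ldots\}$, $P_0=K$, $P_i=K[x_1,\ldots,x_i]$, $\partial_i=\partial/\partial x_i$. For $n\ge 2$, $\mathfrak{u}_n=K\partial_1+P_1\partial_2+\cdots+P_{n-1}\partial_n$, a Lie subalgebra of $\mathrm{Der}_K(P_n)$. $\mathfrak{u}_n$ has the $K$-basis $\mathcal{B}_n=\{X_{\alpha,i}=x^\alpha\partial_i \mid 1\le i\le n,\ \alpha\in\mathbb{N}^{i-1}\}$, where $x^\alpha=x_1^{\alpha_1}\cdots x_{i-1}^{\alpha_{i-1}}$. It is well ordered by: $X_{\alpha,i}>X_{\beta,j}$ iff $i<j$, or $i=j$ and for some $m$ one has $\alpha_m>\beta_m$ and $\alpha_k=\beta_k$ for all $m<k\le i-1$. Its order type is $\omega^{n-1}+\omega^{n-2}+\cdots+\omega+1$, where $\omega$ is the first infinite ordinal. For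 $X\in\mathcal{B}_n$ let $\mathrm{ord}(X)$ be the order type of $\{Y\in\mathcal{B}_n\mid Y\le X\}$. For an ordinal $\lambda$ with $1\le\lambda\le\omega^{n-1}+\cdots+\omega+1$ put $I_\lambda=\bigoplus\{KX\mid X\in\mathcal{B}_n,\ \mathrm{ord}(X)\le\lambda\}$, an ideal of $\mathfrak{u}_n$. For a Lie algebra $\mathcal{G}$, the central series is defined by transfinite recursion: $Z^{(0)}(\mathcal{G})=0$; $Z^{(\mu+1)}(\mathcal{G})=\pi_\mu^{-1}\bigl(Z(\mathcal{G}/Z^{(\mu)}(\mathcal{G}))\bigr)$, where $\pi_\mu:\mathcal{G}\to\mathcal{G}/Z^{(\mu)}(\mathcal{G})$ is the canonical map and $Z(\cdot)$ denotes the centre; and $Z^{(\lambda)}(\mathcal{G})=\bigcup_{\mu<\lambda}Z^{(\mu)}(\mathcal{G})$ for limit $\lambda$. The central dimension $\mathrm{c.dim}(\mathcal{G})$ is the least ordinal $\lambda$ with $Z^{(\lambda)}(\mathcal{G})=\bigcup_{\mu}Z^{(\mu)}(\mathcal{G})$ (union over all ordinals $\mu$). *)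

theory Defs
  imports "HOL-Algebra.QuotRing" "HOL-Algebra.Module" "HOL-Library.Poly_Mapping"
    "HOL-Library.Infinite_Typeclass"
begin

unbundle cardinal_syntax

section \<open>Ordinals\<close>

text \<open>
  The ordinals of cardinality at most that of \<open>'b\<close>: isomorphism classes of well-orders on
  subsets of \<open>'b\<close>. A statement about \<open>'b ordinal\<close> for an arbitrary infinite type \<open>'b\<close> is a
  statement about all ordinals that HOL can speak of, since every well-order on any type \<open>'c\<close> is
  isomorphic to one on a subset of the infinite type \<open>'c + nat\<close>.
\<close>

quotient_type 'b ordinal = "'b rel" / partial: "\<lambda>r s. r =o s"
proof (rule part_equivpI)
  show "\<exists>r :: 'b rel. r =o r"
    using card_of_Well_order ordIso_reflexive by blast
  show "symp (\<lambda>r s :: 'b rel. r =o s)"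
    by (auto intro: sympI ordIso_symmetric)
  show "transp (\<lambda>r s :: 'b rel. r =o s)"
    by (auto intro: transpI ordIso_transitive)
qed

lemma rep_ordinal_refl: "rep_ordinal a =o rep_ordinal a"
  by (rule Quotient3_rep_reflp[OF Quotient3_ordinal])

lemma rep_ordinal_Well_order: "Well_order (rep_ordinal a)"
  using rep_ordinal_refl[of a] by (auto simp: ordIso_def)

instantiation ordinal :: (type) wellorder
begin

definition less_eq_ordinal :: "'a ordinal \<Rightarrow> 'a ordinal \<Rightarrow> bool"
  where "a \<le> b \<longleftrightarrow> rep_ordinal a \<le>o rep_ordinal b"

definition less_ordinal :: "'a ordinal \<Rightarrow> 'a ordinal \<Rightarrow> bool"
  where "a < b \<longleftrightarrow> rep_ordinal a <o rep_ordinal b"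

instance
proof
  fix a b c :: "'a ordinal"
  show "a < b \<longleftrightarrow> a \<le> b \<and> \<not> b \<le> a"
    unfolding less_eq_ordinal_def less_ordinal_def
    using not_ordLess_ordLeq ordLess_imp_ordLeq not_ordLeq_iff_ordLess rep_ordinal_Well_order
    by metis
  show "a \<le> a"
    unfolding less_eq_ordinal_def by (rule ordLeq_reflexive[OF rep_ordinal_Well_order])
  show "a \<le> b \<Longrightarrow> b \<le> c \<Longrightarrow> a \<le> c"
    unfolding less_eq_ordinal_def by (rule ordLeq_transitive)
  show "a = b" if "a \<le> b" "b \<le> a"
  proof -
    have "rep_ordinal a =o rep_ordinal b"
      using that ordIso_iff_ordLeq unfolding less_eq_ordinal_def by blast
    then show ?thesis
      using Quotient3_rel_rep[OF Quotient3_ordinal] by blast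
  qed
  show "a \<le> b \<or> b \<le> a"
    unfolding less_eq_ordinal_def by (rule ordLeq_total[OF rep_ordinal_Well_order rep_ordinal_Well_order])
next
  fix P :: "'a ordinal \<Rightarrow> bool" and a
  assume step: "\<And>x. (\<And>y. y < x \<Longrightarrow> P y) \<Longrightarrow> P x"
  have "wf (inv_image ordLess (rep_ordinal :: 'a ordinal \<Rightarrow> 'a rel))"
    by (rule wf_inv_image[OF wf_ordLess])
  then show "P a"
    by (induction a rule: wf_induct_rule) (auto intro: step simp: less_ordinal_def)
qed

end

text \<open>
  The order type of a well-order on an arbitrary type. It is meaningful if a well-order on \<open>'b\<close>
  isomorphic to \<open>r\<close> exists, in particular if \<open>r\<close> is countable and \<open>'b\<close> is infinite.
\<close>

definition ordtype :: "'c rel \<Rightarrow> 'b ordinal"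
  where "ordtype r = abs_ordinal (SOME s. s =o r)"

text \<open>
  Cantor's definitions of the sum (first \<open>r\<close>, then \<open>s\<close>) and of the product (\<open>s\<close> many copies of
  \<open>r\<close>, i.e. the antilexicographic order) of well-orders.
\<close>

definition wo_sum :: "'c rel \<Rightarrow> 'd rel \<Rightarrow> ('c + 'd) rel"
  where "wo_sum r s =
    {(Inl x, Inl y) | x y. (x, y) \<in> r} \<union> {(Inr x, Inr y) | x y. (x, y) \<in> s} \<union>
    {(Inl x, Inr y) | x y. x \<in> Field r \<and> y \<in> Field s}"

definition wo_prod :: "'c rel \<Rightarrow> 'd rel \<Rightarrow> ('c \<times> 'd) rel"
  where "wo_prod r s =
    {((x, y), (x', y')) | x y x' y'. x \<in> Field r \<and> x' \<in> Field r \<and>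
      ((y, y') \<in> s \<and> y \<noteq> y' \<or> y \<in> Field s \<and> y = y' \<and> (x, x') \<in> r)}"

instantiation ordinal :: (type) "{zero, plus, power}"
begin

definition "0 = (ordtype ({} :: unit rel) :: 'a ordinal)"
definition "1 = (ordtype ({((), ())} :: unit rel) :: 'a ordinal)"
definition "a + b = (ordtype (wo_sum (rep_ordinal a) (rep_ordinal b)) :: 'a ordinal)"
definition "a * b = (ordtype (wo_prod (rep_ordinal a) (rep_ordinal b)) :: 'a ordinal)"

instance ..

end

definition omega :: "'b ordinal"
  where "omega = ordtype natLeq"

text \<open>\<open>\<omega>\<^bsup>n-1\<^esup> + \<omega>\<^bsup>n-2\<^esup> + \<dots> + \<omega> + 1\<close>, with the summands in this order.\<close>

primrec omega_sum :: "nat \<Rightarrow> 'b ordinal"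
  where
    "omega_sum 0 = 0"
  | "omega_sum (Suc k) = omega ^ k + omega_sum k"

section \<open>The central series of a Lie algebra\<close>

text \<open>
  A Lie algebra is represented by a \<^typ>\<open>('k, 'g) module\<close> record whose product \<open>\<otimes>\<close> is the Lie
  bracket (the field \<open>one\<close> is irrelevant). Then the quotient by an ideal is given by the
  library's \<open>Quot\<close>, and the canonical map is \<open>\<lambda>x. I +> x\<close>.
\<close>

definition lie_centre :: "('g, 'm) ring_scheme \<Rightarrow> 'g set"
  where "lie_centre L = {x \<in> carrier L. \<forall>y \<in> carrier L. x \<otimes>\<^bsub>L\<^esub> y = \<zero>\<^bsub>L\<^esub>}"

definition centre_preimage :: "('g, 'm) ring_scheme \<Rightarrow> 'g set \<Rightarrow> 'g set"
  where "centre_preimage L I = {x \<in> carrier L. I +>\<^bsub>L\<^esub> x \<in> lie_centre (L Quot I)}"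

text \<open>
  \<open>is_succ_of a b\<close> says \<open>a = b + 1\<close>. In this form the recursion below terminates without a proof
  that \<open>b < b + 1\<close>, which fails for finite \<open>'b\<close>.
\<close>

definition is_succ_of :: "'o \<Rightarrow> 'o::wellorder \<Rightarrow> bool"
  where "is_succ_of a b \<longleftrightarrow> b < a \<and> (\<forall>c < a. c \<le> b)"

lemma is_succ_of_unique: "is_succ_of a b \<Longrightarrow> is_succ_of a c \<Longrightarrow> b = c"
  by (auto simp: is_succ_of_def intro: antisym)

lemma the_is_succ_of: "is_succ_of a b \<Longrightarrow> (THE b. is_succ_of a b) = b"
  by (blast intro: is_succ_of_unique)

function central_series :: "('g, 'm) ring_scheme \<Rightarrow> 'b ordinal \<Rightarrow> 'g set"
  where "central_series L a =
    (if a = 0 then {\<zero>\<^bsub>L\<^esub>}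
     else if \<exists>b. is_succ_of a b
       then centre_preimage L (central_series L (THE b. is_succ_of a b))
     else (\<Union>b \<in> {..<a}. central_series L b))"
  by auto
termination
  by (relation "inv_image {(a, b). a < b} snd")
    (auto simp: wf the_is_succ_of is_succ_of_def[symmetric] dest: the_is_succ_of
      intro: wf_inv_image, auto simp: is_succ_of_def)

declare central_series.simps [simp del]

text \<open>
  The least ordinal at which the series reaches the union of all its terms. (If there is no such
  ordinal of cardinality at most that of \<open>'b\<close>, the value is unspecified.)
\<close>

definition c_dim :: "('g, 'm) ring_scheme \<Rightarrow> 'b ordinal"
  where "c_dim L = (LEAST a. central_series L a = (\<Union>b :: 'b ordinal. central_series L b))"

definition lin_span :: "('k, 'g, 'm) module_scheme \<Rightarrow> 'g set \<Rightarrow> 'g set"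
  where "lin_span L S = {\<Oplus>\<^bsub>L\<^esub>x\<in>F. c x \<odot>\<^bsub>L\<^esub> x | c F. finite F \<and> F \<subseteq> S}"

section \<open>Polynomials and derivations\<close>

text \<open>
  Polynomials in the variables \<open>x\<^sub>i\<close>, \<open>i :: nat\<close>, as finitely supported functions from exponent
  vectors to coefficients.
\<close>

type_synonym 'k mpoly = "(nat \<Rightarrow>\<^sub>0 nat) \<Rightarrow>\<^sub>0 'k"

definition pol :: "nat \<Rightarrow> 'k::zero mpoly set"
  where "pol i = {p. \<forall>\<alpha> \<in> Poly_Mapping.keys p. Poly_Mapping.keys \<alpha> \<subseteq> {1..i}}"

definition const :: "'k::zero \<Rightarrow> 'k mpoly"
  where "const c = Poly_Mapping.single 0 c"

definition xpow :: "(nat \<Rightarrow>\<^sub>0 nat) \<Rightarrow> 'k::zero_neq_one mpoly"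
  where "xpow \<alpha> = Poly_Mapping.single \<alpha> 1"

text \<open>
  \<open>\<partial>\<^sub>i(x\<^sup>\<alpha>) = \<alpha>\<^sub>i x\<^sup>\<alpha> / x\<^sub>i\<close>. If \<open>\<alpha>\<^sub>i = 0\<close>, the subtraction in the exponent truncates, but the
  coefficient is \<open>0\<close>.
\<close>

definition partial_deriv :: "nat \<Rightarrow> 'k::comm_semiring_1 mpoly \<Rightarrow> 'k mpoly"
  where "partial_deriv i p = (\<Sum>\<alpha> \<in> Poly_Mapping.keys p.
    Poly_Mapping.single (\<alpha> - Poly_Mapping.single i 1)
      (of_nat (Poly_Mapping.lookup \<alpha> i) * Poly_Mapping.lookup p \<alpha>))"

text \<open>
  \<open>Der\<^sub>K(P\<^sub>n)\<close>. A map \<open>P\<^sub>n \<rightarrow> P\<^sub>n\<close> is represented by the function on all polynomials that is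
  \<^const>\<open>undefined\<close> outside \<open>P\<^sub>n\<close>.
\<close>

type_synonym 'k lie_der = "('k, 'k mpoly \<Rightarrow> 'k mpoly) module"

definition Der :: "nat \<Rightarrow> 'k::field lie_der"
  where "Der n = \<lparr>
    carrier = {D \<in> pol n \<rightarrow>\<^sub>E pol n.
      (\<forall>p \<in> pol n. \<forall>q \<in> pol n. D (p + q) = D p + D q) \<and>
      (\<forall>c. \<forall>p \<in> pol n. D (const c * p) = const c * D p) \<and>
      (\<forall>p \<in> pol n. \<forall>q \<in> pol n. D (p * q) = D p * q + p * D q)},
    mult = (\<lambda>D E. \<lambda>p\<in>pol n. D (E p) - E (D p)),
    one = undefined,
    zero = (\<lambda>p\<in>pol n. 0),
    add = (\<lambda>D E. \<lambda>p\<in>pol n. D p + E p),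
    smult = (\<lambda>c D. \<lambda>p\<in>pol n. const c * D p)\<rparr>"

section \<open>The Lie algebra of triangular derivations\<close>

text \<open>
  \<open>\<uu>\<^sub>n = K\<partial>\<^sub>1 + P\<^sub>1\<partial>\<^sub>2 + \<dots> + P\<^bsub>n-1\<^esub>\<partial>\<^sub>n\<close>, with the operations of \<open>Der\<^sub>K(P\<^sub>n)\<close>.
\<close>

definition tri :: "nat \<Rightarrow> 'k::field lie_der"
  where "tri n = (Der n)\<lparr>carrier :=
    {(\<lambda>p\<in>pol n. \<Sum>i=1..n. f i * partial_deriv i p) | f. \<forall>i\<in>{1..n}. f i \<in> pol (i - 1)}\<rparr>"

definition basis_elt :: "nat \<Rightarrow> (nat \<Rightarrow>\<^sub>0 nat) \<Rightarrow> nat \<Rightarrow> ('k::field mpoly \<Rightarrow> 'k mpoly)"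
  where "basis_elt n \<alpha> i = (\<lambda>p\<in>pol n. xpow \<alpha> * partial_deriv i p)"

definition basis_index :: "nat \<Rightarrow> ((nat \<Rightarrow>\<^sub>0 nat) \<times> nat) set"
  where "basis_index n = {(\<alpha>, i). i \<in> {1..n} \<and> Poly_Mapping.keys \<alpha> \<subseteq> {1..i-1}}"

definition tri_basis :: "nat \<Rightarrow> ('k::field mpoly \<Rightarrow> 'k mpoly) set"
  where "tri_basis n = {basis_elt n \<alpha> i | \<alpha> i. (\<alpha>, i) \<in> basis_index n}"

definition index_greater :: "(nat \<Rightarrow>\<^sub>0 nat) \<times> nat \<Rightarrow> (nat \<Rightarrow>\<^sub>0 nat) \<times> nat \<Rightarrow> bool"
  where "index_greater = (\<lambda>(\<alpha>, i) (\<beta>, j). i < j \<or>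
    i = j \<and> (\<exists>m\<in>{1..i-1}. Poly_Mapping.lookup \<alpha> m > Poly_Mapping.lookup \<beta> m \<and>
      (\<forall>k. m < k \<and> k \<le> i - 1 \<longrightarrow> Poly_Mapping.lookup \<alpha> k = Poly_Mapping.lookup \<beta> k)))"

text \<open>The reflexive order on the basis: \<open>(Y, X)\<close> is in it iff \<open>Y \<le> X\<close>.\<close>

definition basis_order :: "nat \<Rightarrow> ('k::field mpoly \<Rightarrow> 'k mpoly) rel"
  where "basis_order n = {(Y, X). Y \<in> tri_basis n \<and> X \<in> tri_basis n \<and>
    (Y = X \<or> (\<exists>\<alpha> i \<beta> j. (\<alpha>, i) \<in> basis_index n \<and> (\<beta>, j) \<in> basis_index n \<and>
       X = basis_elt n \<alpha> i \<and> Y = basis_elt n \<beta> j \<and> index_greater (\<alpha>, i) (\<beta>, j)))}"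

definition basis_ord :: "nat \<Rightarrow> ('k::field mpoly \<Rightarrow> 'k mpoly) \<Rightarrow> 'b ordinal"
  where "basis_ord n X = ordtype (Restr (basis_order n) {Y. (Y, X) \<in> basis_order n})"

text \<open>The ideal \<open>I\<^sub>a\<close>; the sum of the lines \<open>K X\<close> is direct since the \<open>X\<close> are linearly independent.\<close>

definition tri_ideal :: "nat \<Rightarrow> 'b ordinal \<Rightarrow> ('k::field mpoly \<Rightarrow> 'k mpoly) set"
  where "tri_ideal n a = lin_span (tri n) {X \<in> tri_basis n. basis_ord n X \<le> a}"

end

theory Submission
  imports Defs
begin

text \<open>
  An element of \<open>\<uu>\<^sub>n\<close> is \<open>D = f\<^sub>1\<partial>\<^sub>1 + \<dots> + f\<^sub>n\<partial>\<^sub>n\<close> with \<open>f\<^sub>i \<in> P\<^bsub>i-1\<^esub>\<close>, and \<open>f\<^sub>i = D(x\<^sub>i)\<close> is determined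
  by \<open>D\<close>. So \<open>D\<close> is described by its support, the finite set of indices \<open>(\<alpha>, i)\<close> such that \<open>x\<^sup>\<alpha>\<close>
  occurs in \<open>f\<^sub>i\<close>, and the span of a set \<open>J\<close> of basis elements consists of the \<open>D\<close> whose support
  is contained in \<open>J\<close>.

  The heart of the proof is one step of the central series, which does not mention ordinals: for a
  basis element \<open>Z\<close>, the elements that are central modulo the span of the \<open>Y < Z\<close> are exactly
  those in the span of the \<open>Y \<le> Z\<close> (\<open>centre_preimage_supported_underS\<close>).

  One inclusion holds since every monomial of \<open>[D, E]\<close> lies strictly below some monomial of \<open>D\<close>
  (\<open>support_bracket\<close>): a term \<open>f\<^sub>i \<partial>\<^sub>i(g\<^sub>k) \<partial>\<^sub>k\<close> is nonzero only for \<open>i < k\<close>, which places it below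
  everything in \<open>P\<^bsub>i-1\<^esub>\<partial>\<^sub>i\<close>, and a term \<open>g\<^sub>i \<partial>\<^sub>i(f\<^sub>k) \<partial>\<^sub>k\<close> has smaller exponents than the monomial
  of \<open>f\<^sub>k\<close> that it comes from, because the multiplication by \<open>g\<^sub>i\<close> affects only the less
  significant variables \<open>x\<^sub>1, \<dots>, x\<^bsub>i-1\<^esub>\<close>.

  For the other inclusion (\<open>exists_bracket_not_below\<close>), let \<open>Z = x\<^sup>\<beta>\<partial>\<^sub>j\<close> and let \<open>D\<close> have a
  monomial above \<open>Z\<close>. If \<open>f\<^sub>i \<noteq> 0\<close> for some \<open>i < j\<close>, take the least such \<open>i\<close> and
  \<open>E = x\<^sup>\<beta>x\<^sub>i \<partial>\<^sub>j\<close>; then \<open>[D, E]\<close> contains \<open>x\<^sup>\<alpha>x\<^sup>\<beta>\<partial>\<^sub>j\<close> for every monomial \<open>x\<^sup>\<alpha>\<close> of \<open>f\<^sub>i\<close>, with a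
  coefficient that does not vanish in characteristic zero. Otherwise \<open>f\<^sub>j\<close> has a monomial \<open>x\<^sup>\<alpha>\<close>
  above \<open>x\<^sup>\<beta>\<close>. Let \<open>m\<close> be the last position where \<open>\<alpha>\<close> and \<open>\<beta>\<close> differ, and let \<open>\<gamma>\<close> agree with \<open>\<beta>\<close>
  before \<open>m\<close> and be \<open>0\<close> from \<open>m\<close> on; then bracketing with \<open>x\<^sup>\<gamma>\<partial>\<^sub>m\<close> turns \<open>x\<^sup>\<alpha>\<close> into a monomial
  that is still divisible by \<open>x\<^sup>\<beta>\<close>. In both cases \<open>[D, E]\<close> is not in the span of the \<open>Y < Z\<close>.

  The rest is about well-orders. The block of \<open>\<partial>\<^sub>i\<close> in the basis is ordered like \<open>\<nat>\<^bsup>i-1\<^esup>\<close>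
  antilexicographically, hence has order type \<open>\<omega>\<^bsup>i-1\<^esup>\<close>, and the blocks follow each other from
  \<open>i = n\<close> down to \<open>i = 1\<close>; so the order type of the basis is \<open>\<omega>\<^bsup>n-1\<^esup> + \<dots> + \<omega> + 1\<close>
  (\<open>omega_sum_index_order\<close>). The ordinals \<open>ord(X)\<close> are the successor ordinals up to this one, each
  attained once. Transfinite induction now gives \<open>Z\<^bsup>(\<lambda>)\<^esup> = I\<^sub>\<lambda>\<close>: the step above is the successor
  case, and at a limit \<open>\<lambda>\<close> nothing new enters \<open>I\<^sub>\<lambda>\<close> because \<open>\<lambda>\<close> is not of the form \<open>ord(X)\<close> and
  supports are finite. The series is strictly increasing up to the order type of the basis, where
  it reaches all of \<open>\<uu>\<^sub>n\<close>.
\<close>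

section \<open>Well-orders and ordinal arithmetic\<close>

lemma rep_ordinal_abs: "Well_order s \<Longrightarrow> rep_ordinal (abs_ordinal s) =o s"
  by (rule rep_abs_rsp_left[OF Quotient3_ordinal]) (rule ordIso_reflexive)

text \<open>
  The choice in the definition of \<open>ordtype\<close> succeeds as soon as the field of \<open>r\<close> injects into
  the type from which the ordinals are built: transport \<open>r\<close> along the injection.
\<close>

lemma rep_ordtype:
  fixes f :: "'c \<Rightarrow> 'b"
  assumes r: "Well_order r" and f: "inj_on f (Field r)"
  shows "rep_ordinal (ordtype r :: 'b ordinal) =o r"
proof -
  have "dir_image r f =o r"
    using dir_image_ordIso[OF r f] by (rule ordIso_symmetric)
  then have s: "(SOME s :: 'b rel. s =o r) =o r"
    by (rule someI)
  then have "Well_order (SOME s :: 'b rel. s =o r)"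
    by (auto simp: ordIso_def)
  then show ?thesis
    unfolding ordtype_def using rep_ordinal_abs s ordIso_transitive by blast
qed

lemma rep_ordtype_ordLeq:
  assumes "r \<le>o rep_ordinal (a :: 'b ordinal)"
  shows "rep_ordinal (ordtype r :: 'b ordinal) =o r"
proof -
  have "Well_order r"
    using assms by (auto simp: ordLeq_def)
  moreover obtain f :: "'a \<Rightarrow> 'b" where "inj_on f (Field r)"
    using card_of_mono2[OF assms] unfolding card_of_ordLeq[symmetric] by blast
  ultimately show ?thesis
    by (rule rep_ordtype)
qed

lemma ordinal_eqI: "rep_ordinal a =o r \<Longrightarrow> rep_ordinal b =o r \<Longrightarrow> a = b"
  by (rule iffD1[OF Quotient3_rel_rep[OF Quotient3_ordinal]])
    (blast intro: ordIso_symmetric ordIso_transitive)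

lemma Field_wo_sum: "Field (wo_sum r s) = Field r <+> Field s"
proof (intro equalityI subsetI)
  show "x \<in> Field r <+> Field s" if "x \<in> Field (wo_sum r s)" for x
    using that unfolding Field_def wo_sum_def by (auto 0 3)
  show "x \<in> Field (wo_sum r s)" if "x \<in> Field r <+> Field s" for x
    using that unfolding Field_def wo_sum_def by (cases x) (simp_all add: Domain_iff Range_iff, blast+)
qed

lemma Field_wo_prod:
  assumes "Refl r" "Refl s"
  shows "Field (wo_prod r s) = Field r \<times> Field s"
proof
  show "Field (wo_prod r s) \<subseteq> Field r \<times> Field s"
    unfolding wo_prod_def Field_def by auto
  show "Field r \<times> Field s \<subseteq> Field (wo_prod r s)"
  proof
    fix p assume "p \<in> Field r \<times> Field s"
    then have "(p, p) \<in> wo_prod r s"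
      using assms by (auto simp: wo_prod_def refl_on_def)
    then show "p \<in> Field (wo_prod r s)"
      by (rule FieldI1)
  qed
qed

lemma Well_orderI:
  assumes "Refl r" "trans r" "antisym r" "Total r" "wf (r - Id)"
  shows "Well_order r"
  using assms unfolding well_order_on_def linear_order_on_def partial_order_on_def preorder_on_def
  by (auto intro: FieldI1 FieldI2)

lemma Well_orderD:
  assumes "Well_order r"
  shows "Refl r" "trans r" "antisym r" "Total r" "wf (r - Id)"
  using assms unfolding well_order_on_def linear_order_on_def partial_order_on_def preorder_on_def
  by auto

lemma Well_order_wo_sum:
  assumes r: "Well_order r" and s: "Well_order s"
  shows "Well_order (wo_sum r s)"
proof (rule Well_orderI)
  note R = Well_orderD[OF r] and S = Well_orderD[OF s]
  show "Refl (wo_sum r s)"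
    using R(1) S(1) unfolding refl_on_def Field_wo_sum by (auto simp: wo_sum_def)
  show "trans (wo_sum r s)"
  proof (rule transI)
    fix x y z assume "(x, y) \<in> wo_sum r s" "(y, z) \<in> wo_sum r s"
    then show "(x, z) \<in> wo_sum r s"
      by (cases x; cases y; cases z)
        (auto simp: wo_sum_def intro: FieldI1 FieldI2 transD[OF R(2)] transD[OF S(2)])
  qed
  show "antisym (wo_sum r s)"
    using R(3) S(3) unfolding antisym_def wo_sum_def by auto
  show "Total (wo_sum r s)"
  proof (unfold total_on_def Field_wo_sum, intro ballI impI)
    fix x y assume "x \<in> Field r <+> Field s" "y \<in> Field r <+> Field s" "x \<noteq> y"
    then show "(x, y) \<in> wo_sum r s \<or> (y, x) \<in> wo_sum r s"
      using R(4) S(4) unfolding total_on_def by (cases x; cases y) (auto simp: wo_sum_def)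
  qed
  show "wf (wo_sum r s - Id)"
  proof (rule wfI_min)
    fix x and Q :: "('a + 'b) set" assume "x \<in> Q"
    show "\<exists>z\<in>Q. \<forall>y. (y, z) \<in> wo_sum r s - Id \<longrightarrow> y \<notin> Q"
    proof (cases "\<exists>u. Inl u \<in> Q")
      case True
      then obtain u where "Inl u \<in> Q" "\<And>v. (v, u) \<in> r - Id \<Longrightarrow> Inl v \<notin> Q"
        using wfE_min[OF R(5), of _ "{u. Inl u \<in> Q}"] by (metis mem_Collect_eq)
      then show ?thesis
        by (intro bexI[of _ "Inl u"]) (auto simp: wo_sum_def)
    next
      case False
      with \<open>x \<in> Q\<close> obtain w where "Inr w \<in> Q"
        by (cases x) auto
      then obtain u where "Inr u \<in> Q" "\<And>v. (v, u) \<in> s - Id \<Longrightarrow> Inr v \<notin> Q"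
        using wfE_min[OF S(5), of _ "{u. Inr u \<in> Q}"] by (metis mem_Collect_eq)
      then show ?thesis
        using False by (intro bexI[of _ "Inr u"]) (auto simp: wo_sum_def)
    qed
  qed
qed

lemma Well_order_wo_prod:
  assumes r: "Well_order r" and s: "Well_order s"
  shows "Well_order (wo_prod r s)"
proof (rule Well_orderI)
  note R = Well_orderD[OF r] and S = Well_orderD[OF s]
  note F = Field_wo_prod[OF R(1) S(1)]
  show "Refl (wo_prod r s)"
    using R(1) S(1) unfolding refl_on_def F by (auto simp: wo_prod_def)
  show "trans (wo_prod r s)"
  proof (rule transI)
    fix x y z assume xy: "(x, y) \<in> wo_prod r s" and yz: "(y, z) \<in> wo_prod r s"
    obtain a b c d e f where [simp]: "x = (a, b)" "y = (c, d)" "z = (e, f)"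
      by (cases x, cases y, cases z)
    have "(b, f) \<in> s \<and> b \<noteq> f" if "(b, d) \<in> s" "(d, f) \<in> s" "b \<noteq> d \<or> d \<noteq> f"
      using that transD[OF S(2)] antisymD[OF S(3)] by metis
    then show "(x, z) \<in> wo_prod r s"
      using xy yz S(1) transD[OF R(2)] unfolding wo_prod_def by (auto simp: refl_on_def)
  qed
  show "antisym (wo_prod r s)"
    using R(3) S(3) unfolding antisym_def wo_prod_def by auto
  show "Total (wo_prod r s)"
  proof (unfold total_on_def F, intro ballI impI)
    fix x y assume "x \<in> Field r \<times> Field s" "y \<in> Field r \<times> Field s" "x \<noteq> y"
    then show "(x, y) \<in> wo_prod r s \<or> (y, x) \<in> wo_prod r s"
      using R(4)[unfolded total_on_def, rule_format, of "fst x" "fst y"]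
        S(4)[unfolded total_on_def, rule_format, of "snd x" "snd y"]
      by (cases x; cases y) (auto simp: wo_prod_def)
  qed
  have "wf (inv_image ((s - Id) <*lex*> (r - Id)) prod.swap)"
    using R(5) S(5) by (intro wf_inv_image wf_lex_prod)
  then show "wf (wo_prod r s - Id)"
    by (rule wf_subset) (auto simp: wo_prod_def)
qed

lemma ordIsoI:
  assumes "Well_order r" "inj_on f (Field r)" "Field r' = f ` Field r"
    and iff: "\<And>x y. x \<in> Field r \<Longrightarrow> y \<in> Field r \<Longrightarrow> (f x, f y) \<in> r' \<longleftrightarrow> (x, y) \<in> r"
  shows "r =o r'"
proof -
  have "r' = dir_image r f"
  proof (intro equalityI subsetI)
    fix p assume "p \<in> r'"
    then obtain x y where "p = (f x, f y)" "x \<in> Field r" "y \<in> Field r"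
      using assms(3) by (cases p) (metis FieldI1 FieldI2 imageE)
    then show "p \<in> dir_image r f"
      using \<open>p \<in> r'\<close> iff by (auto simp: dir_image_def)
  next
    fix p assume "p \<in> dir_image r f"
    then obtain x y where "p = (f x, f y)" "(x, y) \<in> r"
      by (auto simp: dir_image_def)
    then show "p \<in> r'"
      using iff FieldI1 FieldI2 by metis
  qed
  then show ?thesis
    using dir_image_ordIso assms(1,2) by metis
qed

lemma ordIsoE:
  assumes "r =o r'"
  obtains f where "Well_order r" "Well_order r'" "inj_on f (Field r)" "Field r' = f ` Field r"
    "\<forall>x\<in>Field r. \<forall>y\<in>Field r. (f x, f y) \<in> r' \<longleftrightarrow> (x, y) \<in> r"
proof -
  have "Well_order r \<and> Well_order r' \<and> (\<exists>f. BNF_Wellorder_Embedding.iso r r' f)"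
    using assms unfolding ordIso_def by simp
  then obtain f where f: "Well_order r" "Well_order r'" "BNF_Wellorder_Embedding.iso r r' f"
    by blast
  have "inj_on f (Field r)" "Field r' = f ` Field r"
    "\<forall>x\<in>Field r. \<forall>y\<in>Field r. (f x, f y) \<in> r' \<longleftrightarrow> (x, y) \<in> r"
    using f(3) unfolding iso_iff2 bij_betw_def by blast+
  with f(1,2) show thesis
    by (rule that)
qed

text \<open>
  Invariance under isomorphism reduces arithmetic on abstract ordinals to concrete well-orders.
\<close>

lemma wo_sum_cong:
  assumes "r =o r'" "s =o s'"
  shows "wo_sum r s =o wo_sum r' s'"
proof -
  obtain f where r: "Well_order r" "Well_order r'" and f: "inj_on f (Field r)" "Field r' = f ` Field r"
    "\<forall>x\<in>Field r. \<forall>y\<in>Field r. (f x, f y) \<in> r' \<longleftrightarrow> (x, y) \<in> r"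
    by (rule ordIsoE[OF assms(1)]) (rule that)
  obtain g where s: "Well_order s" "Well_order s'" and g: "inj_on g (Field s)" "Field s' = g ` Field s"
    "\<forall>x\<in>Field s. \<forall>y\<in>Field s. (g x, g y) \<in> s' \<longleftrightarrow> (x, y) \<in> s"
    by (rule ordIsoE[OF assms(2)]) (rule that)
  show ?thesis
  proof (rule ordIsoI[where f = "map_sum f g"])
    show "Well_order (wo_sum r s)"
      by (rule Well_order_wo_sum[OF r(1) s(1)])
    show "inj_on (map_sum f g) (Field (wo_sum r s))"
      unfolding Field_wo_sum by (auto intro!: inj_onI dest: inj_onD[OF f(1)] inj_onD[OF g(1)])
    show "Field (wo_sum r' s') = map_sum f g ` Field (wo_sum r s)"
      unfolding Field_wo_sum f(2) g(2) by (simp add: Plus_def image_Un image_image)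
    show "(map_sum f g x, map_sum f g y) \<in> wo_sum r' s' \<longleftrightarrow> (x, y) \<in> wo_sum r s"
      if "x \<in> Field (wo_sum r s)" "y \<in> Field (wo_sum r s)" for x y
      using that f(3) g(3) unfolding Field_wo_sum
      by (cases x; cases y) (auto simp: wo_sum_def f(2) g(2) InlI InrI)
  qed
qed

lemma wo_prod_cong:
  assumes "r =o r'" "s =o s'"
  shows "wo_prod r s =o wo_prod r' s'"
proof -
  obtain f where r: "Well_order r" "Well_order r'" and f: "inj_on f (Field r)" "Field r' = f ` Field r"
    "\<forall>x\<in>Field r. \<forall>y\<in>Field r. (f x, f y) \<in> r' \<longleftrightarrow> (x, y) \<in> r"
    by (rule ordIsoE[OF assms(1)]) (rule that)
  obtain g where s: "Well_order s" "Well_order s'" and g: "inj_on g (Field s)" "Field s' = g ` Field s"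
    "\<forall>x\<in>Field s. \<forall>y\<in>Field s. (g x, g y) \<in> s' \<longleftrightarrow> (x, y) \<in> s"
    by (rule ordIsoE[OF assms(2)]) (rule that)
  note F = Field_wo_prod[OF Well_orderD(1) Well_orderD(1)]
  show ?thesis
  proof (rule ordIsoI[where f = "map_prod f g"])
    show "Well_order (wo_prod r s)"
      by (rule Well_order_wo_prod[OF r(1) s(1)])
    show "inj_on (map_prod f g) (Field (wo_prod r s))"
      using f(1) g(1) unfolding F[OF r(1) s(1)] by (rule map_prod_inj_on)
    show "Field (wo_prod r' s') = map_prod f g ` Field (wo_prod r s)"
      unfolding F[OF r(1) s(1)] F[OF r(2) s(2)] f(2) g(2) by (rule map_prod_surj_on[symmetric]; simp)
    show "(map_prod f g x, map_prod f g y) \<in> wo_prod r' s' \<longleftrightarrow> (x, y) \<in> wo_prod r s"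
      if "x \<in> Field (wo_prod r s)" "y \<in> Field (wo_prod r s)" for x y
      using that f(2,3) g(2,3) inj_on_eq_iff[OF g(1)] unfolding F[OF r(1) s(1)]
      by (cases x; cases y) (simp add: wo_prod_def)
  qed
qed

text \<open>
  For an infinite type, sums and products of its ordinals are represented by well-orders on the
  same type, since \<open>|'b + 'b| = |'b \<times> 'b| = |'b|\<close>; so the arithmetic operations do what their
  definitions intend for all arguments.
\<close>

lemma rep_ordinal_plus:
  "rep_ordinal (a + b :: 'b::infinite ordinal) =o wo_sum (rep_ordinal a) (rep_ordinal b)"
proof -
  have "|UNIV <+> UNIV :: ('b + 'b) set| \<le>o |UNIV :: 'b set|"
    by (rule ordIso_imp_ordLeq[OF conjunct1[OF card_of_Plus_infinite]])
      (use infinite_UNIV card_of_mono1 in auto)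
  then obtain f :: "'b + 'b \<Rightarrow> 'b" where "inj_on f (UNIV <+> UNIV)"
    unfolding card_of_ordLeq[symmetric] by blast
  then show ?thesis
    unfolding plus_ordinal_def
    by (intro rep_ordtype[where f = f] Well_order_wo_sum rep_ordinal_Well_order)
      (auto intro: inj_on_subset)
qed

lemma rep_ordinal_times:
  "rep_ordinal (a * b :: 'b::infinite ordinal) =o wo_prod (rep_ordinal a) (rep_ordinal b)"
proof -
  have "|UNIV \<times> UNIV :: ('b \<times> 'b) set| \<le>o |UNIV :: 'b set|"
    by (rule ordIso_imp_ordLeq[OF conjunct1[OF card_of_Times_infinite]])
      (use infinite_UNIV card_of_mono1 in auto)
  then obtain f :: "'b \<times> 'b \<Rightarrow> 'b" where "inj_on f (UNIV \<times> UNIV)"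
    unfolding card_of_ordLeq[symmetric] by blast
  then show ?thesis
    unfolding times_ordinal_def
    by (intro rep_ordtype[where f = f] Well_order_wo_prod rep_ordinal_Well_order)
      (auto intro: inj_on_subset)
qed

lemma rep_ordinal_omega: "rep_ordinal (omega :: 'b::infinite ordinal) =o natLeq"
proof -
  obtain f :: "nat \<Rightarrow> 'b" where "inj f"
    using infinite_UNIV infinite_countable_subset by blast
  then show ?thesis
    unfolding omega_def by (intro rep_ordtype[where f = f] natLeq_Well_order) (auto intro: inj_on_subset)
qed

lemma Well_order_singleton: "Well_order {(x, x)}"
  by (rule Well_orderI) (auto simp: refl_on_def trans_def antisym_def total_on_def)

lemma rep_ordinal_0: "rep_ordinal (0 :: 'b ordinal) =o ({} :: 'c rel)"
proof -
  have "rep_ordinal (0 :: 'b ordinal) =o ({} :: unit rel)"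
    unfolding zero_ordinal_def by (rule rep_ordtype[where f = undefined]) auto
  moreover have "({} :: unit rel) =o ({} :: 'c rel)"
    using dir_image_ordIso[of "{} :: unit rel" "undefined :: unit \<Rightarrow> 'c"] by (simp add: dir_image_def)
  ultimately show ?thesis
    by (rule ordIso_transitive)
qed

lemma rep_ordinal_1: "rep_ordinal (1 :: 'b ordinal) =o {(x, x)}"
proof -
  have "rep_ordinal (1 :: 'b ordinal) =o {((), ())}"
    unfolding one_ordinal_def
    by (rule rep_ordtype[where f = "\<lambda>_. undefined"]) (rule Well_order_singleton, simp)
  moreover have "{((), ())} =o {(x, x)}"
    using dir_image_ordIso[OF Well_order_singleton[of "()"], of "\<lambda>_. x"] by (simp add: dir_image_def)
  ultimately show ?thesis
    by (rule ordIso_transitive)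
qed

section \<open>Initial segments of a well-order\<close>

text \<open>
  A well-order \<open>r\<close> of order type \<open>\<theta>\<close>. Knowing that \<open>\<theta>\<close> exists in \<open>'b ordinal\<close> ensures that the order
  types of all initial segments of \<open>r\<close> exist there as well.
\<close>

locale well_order_of_type =
  fixes r :: "'c rel" and \<theta> :: "'b ordinal"
  assumes theta: "rep_ordinal \<theta> =o r"
begin

lemma WO: "Well_order r"
  using theta by (auto simp: ordIso_def)

sublocale wo_rel r
  using WO by unfold_locales

text \<open>
  The position of \<open>x\<close>, counted from \<open>1\<close> in the finite case: the segment includes \<open>x\<close> itself. Hence
  positions are always successor ordinals.
\<close>

definition pos :: "'c \<Rightarrow> 'b ordinal"
  where "pos x = ordtype (Restr r (under x))"

lemma r_le: "r \<le>o rep_ordinal \<theta>"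
  using theta by (simp add: ordIso_iff_ordLeq)

lemma Restr_le: "ofilter A \<Longrightarrow> Restr r A \<le>o r"
  using ofilter_subset_ordLeq[OF WO _ Field_ofilter, of A] by (auto simp: ofilter_def Restr_Field)

lemma rep_ordtype_Restr:
  "ofilter A \<Longrightarrow> rep_ordinal (ordtype (Restr r A) :: 'b ordinal) =o Restr r A"
  using Restr_le r_le ordLeq_transitive rep_ordtype_ordLeq by blast

lemma ordtype_Restr_less_iff:
  assumes "ofilter A" "ofilter B"
  shows "(ordtype (Restr r A) :: 'b ordinal) < ordtype (Restr r B) \<longleftrightarrow> A \<subset> B"
proof -
  have "(ordtype (Restr r A) :: 'b ordinal) < ordtype (Restr r B) \<longleftrightarrow> Restr r A <o Restr r B"
    unfolding less_ordinal_def using assms[THEN rep_ordtype_Restr]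
    by (meson ordIso_ordLess_trans ordIso_symmetric ordLess_ordIso_trans)
  then show ?thesis
    using ofilter_subset_ordLess[OF WO assms] by simp
qed

lemma ordtype_Restr_underS_cases:
  assumes "a < \<theta>"
  obtains x where "x \<in> Field r" "a = ordtype (Restr r (underS x))"
proof -
  have "rep_ordinal a <o r"
    using assms theta unfolding less_ordinal_def by (metis ordLess_ordIso_trans)
  then obtain x where x: "x \<in> Field r" "rep_ordinal a =o Restr r (underS x)"
    using ordLess_iff_ordIso_Restr[OF WO rep_ordinal_Well_order] by auto
  then show thesis
    using that ordinal_eqI rep_ordtype_Restr[OF underS_ofilter] by blast
qed

lemma ordtype_r: "\<theta> = ordtype (Restr r (Field r))"
  using theta rep_ordtype_Restr[OF Field_ofilter] by (simp add: ordinal_eqI Restr_Field)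

lemma pos_le: "pos x \<le> \<theta>"
proof -
  have "\<not> \<theta> < pos x"
    unfolding pos_def using ordtype_r ordtype_Restr_less_iff[OF Field_ofilter under_ofilter]
      under_Field[of r x] by auto
  then show ?thesis by simp
qed

text \<open>
  The segment up to and including \<open>x\<close> has one element more than the segment strictly below \<open>x\<close>; a
  smaller ordinal is the type of a segment strictly below some \<open>y\<close>, which is then contained in
  that of \<open>x\<close>.
\<close>

lemma pos_is_succ:
  assumes x: "x \<in> Field r"
  shows "is_succ_of (pos x) (ordtype (Restr r (underS x)))"
  unfolding is_succ_of_def
proof (intro conjI allI impI)
  have xx: "x \<in> under x"
    using x REFL by (auto simp: under_def refl_on_def)
  have "underS x \<subset> under x"
    using xx by (auto simp: underS_def under_def)
  then show "ordtype (Restr r (underS x)) < pos x"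
    unfolding pos_def using ordtype_Restr_less_iff[OF underS_ofilter under_ofilter] by simp
next
  fix c :: "'b ordinal" assume c: "c < pos x"
  then obtain y where y: "y \<in> Field r" "c = ordtype (Restr r (underS y))"
    using order.strict_trans2[OF c pos_le] ordtype_Restr_underS_cases by blast
  then have "underS y \<subset> under x"
    using c ordtype_Restr_less_iff[OF underS_ofilter under_ofilter] by (simp add: pos_def)
  have "\<not> underS x \<subset> underS y"
  proof
    assume sub: "underS x \<subset> underS y"
    then obtain z where z: "z \<in> underS y" "z \<notin> underS x" by auto
    then have "z \<in> Field r" "z \<in> under x"
      using \<open>underS y \<subset> under x\<close> by (auto simp: Field_def underS_def)
    then have "z = x"
      using z(2) by (auto simp: under_def underS_def)
    then have "under x \<subseteq> underS y"
      using z sub by (auto simp: under_def underS_def)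
    then show False
      using \<open>underS y \<subset> under x\<close> by auto
  qed
  then show "c \<le> ordtype (Restr r (underS x))"
    using y ordtype_Restr_less_iff[OF underS_ofilter underS_ofilter, of x y] by (meson not_le)
qed

lemma pos_less_iff:
  assumes "x \<in> Field r" "y \<in> Field r"
  shows "pos x < pos y \<longleftrightarrow> (x, y) \<in> r \<and> x \<noteq> y"
proof -
  have "pos x < pos y \<longleftrightarrow> under x \<subset> under y"
    unfolding pos_def by (rule ordtype_Restr_less_iff[OF under_ofilter under_ofilter])
  also have "\<dots> \<longleftrightarrow> (x, y) \<in> r \<and> x \<noteq> y"
  proof
    assume s: "under x \<subset> under y"
    moreover have "x \<in> under x" "y \<in> under y"
      using assms REFL by (auto simp: under_def refl_on_def)
    ultimately show "(x, y) \<in> r \<and> x \<noteq> y"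
      by (auto simp: under_def)
  next
    assume xy: "(x, y) \<in> r \<and> x \<noteq> y"
    then have "y \<notin> under x"
      using ANTISYM by (auto simp: under_def antisym_def)
    moreover have "y \<in> under y"
      using assms REFL by (auto simp: under_def refl_on_def)
    moreover have "under x \<subseteq> under y"
      using xy TRANS by (auto simp: under_def trans_def)
    ultimately show "under x \<subset> under y" by blast
  qed
  finally show ?thesis .
qed

text \<open>
  Since \<open>a\<close> is the type of the segment strictly below some \<open>x\<close>, its successor is the position of
  that \<open>x\<close>; so positions exhaust the successor ordinals up to \<open>\<theta>\<close>.
\<close>

lemma is_succ_of_pos:
  assumes "a < \<theta>"
  obtains x where "x \<in> Field r" "is_succ_of (pos x) a"
  using assms ordtype_Restr_underS_cases pos_is_succ by metis

end

section \<open>The order type of the basis\<close>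

text \<open>
  Defined on all exponent vectors, without a bound on the variables, so that one relation serves
  the blocks of all \<open>\<partial>\<^sub>i\<close>.
\<close>

definition antilex :: "(nat \<Rightarrow>\<^sub>0 nat) \<Rightarrow> (nat \<Rightarrow>\<^sub>0 nat) \<Rightarrow> bool"
  where "antilex \<alpha> \<beta> \<longleftrightarrow> (\<exists>m. Poly_Mapping.lookup \<alpha> m < Poly_Mapping.lookup \<beta> m \<and>
    (\<forall>k>m. Poly_Mapping.lookup \<alpha> k = Poly_Mapping.lookup \<beta> k))"

text \<open>
  The variables start at an arbitrary \<open>a\<close> because splitting off the least significant one leaves
  the variables from \<open>a + 1\<close> on.
\<close>

definition exp_order :: "nat \<Rightarrow> nat \<Rightarrow> (nat \<Rightarrow>\<^sub>0 nat) rel"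
  where "exp_order a k = {(\<alpha>, \<beta>). Poly_Mapping.keys \<alpha> \<subseteq> {a..<a + k} \<and>
    Poly_Mapping.keys \<beta> \<subseteq> {a..<a + k} \<and> (\<alpha> = \<beta> \<or> antilex \<alpha> \<beta>)}"

lemma Field_exp_order: "Field (exp_order a k) = {\<alpha>. Poly_Mapping.keys \<alpha> \<subseteq> {a..<a + k}}"
  unfolding exp_order_def Field_def by auto

lemma lookup_eq_0_if_keys: "Poly_Mapping.keys \<alpha> \<subseteq> A \<Longrightarrow> j \<notin> A \<Longrightarrow> Poly_Mapping.lookup \<alpha> j = 0"
  by (metis in_keys_iff subsetD)

lemma antilex_irrefl: "\<not> antilex \<alpha> \<alpha>"
  by (simp add: antilex_def)

lemma antilex_single_plus:
  assumes \<beta>: "Poly_Mapping.keys \<beta> \<subseteq> {a<..}" and \<gamma>: "Poly_Mapping.keys \<gamma> \<subseteq> {a<..}"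
  shows "antilex (Poly_Mapping.single a x + \<beta>) (Poly_Mapping.single a y + \<gamma>) \<longleftrightarrow>
    antilex \<beta> \<gamma> \<or> \<beta> = \<gamma> \<and> x < y"
    (is "antilex ?\<beta> ?\<gamma> \<longleftrightarrow> _")
proof -
  have low: "Poly_Mapping.lookup \<beta> k = 0" "Poly_Mapping.lookup \<gamma> k = 0" if "k \<le> a" for k
    using that lookup_eq_0_if_keys[OF \<beta>] lookup_eq_0_if_keys[OF \<gamma>] by auto
  have eq: "Poly_Mapping.lookup ?\<beta> k = (if k = a then x else Poly_Mapping.lookup \<beta> k)"
    "Poly_Mapping.lookup ?\<gamma> k = (if k = a then y else Poly_Mapping.lookup \<gamma> k)" for k
    using low by (auto simp: lookup_add lookup_single when_def)
  show ?thesis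
  proof
    assume "antilex ?\<beta> ?\<gamma>"
    then obtain m where m: "Poly_Mapping.lookup ?\<beta> m < Poly_Mapping.lookup ?\<gamma> m"
      "\<And>k. k > m \<Longrightarrow> Poly_Mapping.lookup ?\<beta> k = Poly_Mapping.lookup ?\<gamma> k"
      unfolding antilex_def by blast
    have "m \<ge> a"
      using m(1) low[of m] by (cases "m \<ge> a") (auto simp: eq split: if_splits)
    show "antilex \<beta> \<gamma> \<or> \<beta> = \<gamma> \<and> x < y"
    proof (cases "m = a")
      case True
      then have "Poly_Mapping.lookup \<beta> k = Poly_Mapping.lookup \<gamma> k" for k
        using m(2)[of k] low[of k] by (cases "k > m") (auto simp: eq)
      then show ?thesis
        using True m(1) by (auto simp: eq intro: poly_mapping_eqI)
    next
      case False
      then show ?thesis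
        using m \<open>m \<ge> a\<close> unfolding antilex_def eq by (intro disjI1 exI[of _ m]) auto
    qed
  next
    assume "antilex \<beta> \<gamma> \<or> \<beta> = \<gamma> \<and> x < y"
    then show "antilex ?\<beta> ?\<gamma>"
    proof
      assume "antilex \<beta> \<gamma>"
      then obtain m where m: "Poly_Mapping.lookup \<beta> m < Poly_Mapping.lookup \<gamma> m"
        "\<And>k. k > m \<Longrightarrow> Poly_Mapping.lookup \<beta> k = Poly_Mapping.lookup \<gamma> k"
        unfolding antilex_def by blast
      moreover have "m > a"
        using m(1) low[of m] by (metis less_numeral_extra(3) not_le)
      ultimately show ?thesis
        unfolding antilex_def eq by (intro exI[of _ m]) auto
    next
      assume "\<beta> = \<gamma> \<and> x < y"
      then show ?thesis
        unfolding antilex_def eq by (intro exI[of _ a]) auto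
    qed
  qed
qed

text \<open>
  Splitting off the least significant variable identifies \<open>\<nat>\<^bsup>k+1\<^esup>\<close> with \<open>\<nat> \<times> \<nat>\<^sup>k\<close>, where the second
  component decides first; this is the product \<open>\<omega> \<cdot> \<omega>\<^sup>k\<close> in Cantor's sense.
\<close>

lemma omega_power_exp_order: "rep_ordinal (omega ^ k :: 'b::infinite ordinal) =o exp_order a k"
proof (induction k arbitrary: a)
  case 0
  have "exp_order a 0 = {(0, 0)}"
    by (auto simp: exp_order_def antilex_def)
  then show ?case
    using rep_ordinal_1 by (simp only: power_0)
next
  case (Suc k)
  let ?r = "wo_prod natLeq (exp_order (Suc a) k)"
  let ?f = "\<lambda>(x, \<beta>). Poly_Mapping.single a x + \<beta>"
  have wo: "Well_order (exp_order (Suc a) k)"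
    using Suc[of "Suc a"] by (auto simp: ordIso_def)
  have F: "Field ?r = UNIV \<times> {\<beta>. Poly_Mapping.keys \<beta> \<subseteq> {Suc a..<Suc a + k}}"
    using Field_wo_prod[OF Well_orderD(1) Well_orderD(1)] wo natLeq_Well_order
    by (metis Field_exp_order Field_natLeq)
  have "?r =o exp_order a (Suc k)"
  proof (rule ordIsoI[where f = ?f])
    show "Well_order ?r"
      by (rule Well_order_wo_prod[OF natLeq_Well_order wo])
    show "inj_on ?f (Field ?r)"
    proof (rule inj_onI)
      fix u v assume u: "u \<in> Field ?r" and v: "v \<in> Field ?r" and eq: "?f u = ?f v"
      have "Poly_Mapping.lookup (snd u) a = 0" "Poly_Mapping.lookup (snd v) a = 0"
        using u v unfolding F by (auto intro!: lookup_eq_0_if_keys[where A = "{Suc a..<Suc (a + k)}"])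
      then have "fst u = fst v"
        using arg_cong[OF eq, of "\<lambda>\<alpha>. Poly_Mapping.lookup \<alpha> a"]
        by (simp add: lookup_add split: prod.splits)
      then show "u = v"
        using eq by (simp add: split_beta prod_eq_iff)
    qed
    show "Field (exp_order a (Suc k)) = ?f ` Field ?r"
      unfolding F Field_exp_order
    proof (intro equalityI subsetI)
      fix \<alpha> :: "nat \<Rightarrow>\<^sub>0 nat" assume "\<alpha> \<in> {\<alpha>. Poly_Mapping.keys \<alpha> \<subseteq> {a..<a + Suc k}}"
      then have \<alpha>: "Poly_Mapping.keys \<alpha> \<subseteq> {a..<a + Suc k}" by simp
      let ?x = "Poly_Mapping.lookup \<alpha> a"
      have "\<alpha> = ?f (?x, \<alpha> - Poly_Mapping.single a ?x)"
        by (rule poly_mapping_eqI) (simp add: lookup_add lookup_minus lookup_single when_def)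
      moreover have "Poly_Mapping.keys (\<alpha> - Poly_Mapping.single a ?x) \<subseteq> {Suc a..<Suc a + k}"
      proof
        fix j assume j: "j \<in> Poly_Mapping.keys (\<alpha> - Poly_Mapping.single a ?x)"
        then have "j \<noteq> a" "j \<in> Poly_Mapping.keys \<alpha>"
          by (auto simp: in_keys_iff lookup_minus lookup_single when_def split: if_splits)
        then show "j \<in> {Suc a..<Suc a + k}"
          using \<alpha> by fastforce
      qed
      ultimately show "\<alpha> \<in> ?f ` (UNIV \<times> {\<beta>. Poly_Mapping.keys \<beta> \<subseteq> {Suc a..<Suc a + k}})"
        by blast
    next
      fix \<alpha> assume "\<alpha> \<in> ?f ` (UNIV \<times> {\<beta>. Poly_Mapping.keys \<beta> \<subseteq> {Suc a..<Suc a + k}})"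
      then obtain x \<beta> where "\<alpha> = Poly_Mapping.single a x + \<beta>"
        "Poly_Mapping.keys \<beta> \<subseteq> {Suc a..<Suc a + k}"
        by auto
      then show "\<alpha> \<in> {\<alpha>. Poly_Mapping.keys \<alpha> \<subseteq> {a..<a + Suc k}}"
        using keys_add[of "Poly_Mapping.single a x" \<beta>] by (fastforce split: if_splits)
    qed
    show "(?f u, ?f v) \<in> exp_order a (Suc k) \<longleftrightarrow> (u, v) \<in> ?r"
      if u: "u \<in> Field ?r" and v: "v \<in> Field ?r" for u v
    proof -
      obtain x \<beta> y \<gamma> where [simp]: "u = (x, \<beta>)" "v = (y, \<gamma>)"
        by (cases u, cases v)
      have \<beta>: "Poly_Mapping.keys \<beta> \<subseteq> {Suc a..<Suc a + k}" "Poly_Mapping.keys \<gamma> \<subseteq> {Suc a..<Suc a + k}"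
        using u v unfolding F by auto
      then have gt: "Poly_Mapping.keys \<beta> \<subseteq> {a<..}" "Poly_Mapping.keys \<gamma> \<subseteq> {a<..}"
        by auto
      have "Poly_Mapping.keys (?f u) \<subseteq> {a..<a + Suc k}" "Poly_Mapping.keys (?f v) \<subseteq> {a..<a + Suc k}"
        using \<beta> keys_add[of "Poly_Mapping.single a x" \<beta>] keys_add[of "Poly_Mapping.single a y" \<gamma>]
        by (fastforce split: if_splits)+
      moreover have "?f u = ?f v \<longleftrightarrow> u = v"
        using \<open>inj_on ?f (Field ?r)\<close> u v by (rule inj_on_eq_iff)
      ultimately have "(?f u, ?f v) \<in> exp_order a (Suc k) \<longleftrightarrow>
          u = v \<or> antilex \<beta> \<gamma> \<or> \<beta> = \<gamma> \<and> x < y"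
        using antilex_single_plus[OF gt] by (simp add: exp_order_def)
      also have "\<dots> \<longleftrightarrow> (u, v) \<in> ?r"
        using \<beta> unfolding wo_prod_def Field_natLeq Field_exp_order
        by (auto simp: exp_order_def natLeq_def antilex_irrefl)
      finally show ?thesis .
    qed
  qed
  moreover have "rep_ordinal (omega ^ Suc k :: 'b ordinal) =o ?r"
    unfolding power_Suc
    by (rule ordIso_transitive[OF rep_ordinal_times wo_prod_cong[OF rep_ordinal_omega Suc]])
  ultimately show ?case
    by (metis ordIso_transitive)
qed

text \<open>
  The order of the basis, transported to the indices: its order type is computed there, by
  combinatorics of exponent vectors.
\<close>

definition index_order :: "nat \<Rightarrow> ((nat \<Rightarrow>\<^sub>0 nat) \<times> nat) rel"
  where "index_order n =
    {(y, z). y \<in> basis_index n \<and> z \<in> basis_index n \<and> (y = z \<or> index_greater z y)}"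

lemma Field_index_order: "Field (index_order n) = basis_index n"
  unfolding index_order_def Field_def by auto

lemma index_greater_iff:
  assumes "Poly_Mapping.keys \<alpha> \<subseteq> {1..i - 1}" "Poly_Mapping.keys \<beta> \<subseteq> {1..j - 1}"
  shows "index_greater (\<alpha>, i) (\<beta>, j) \<longleftrightarrow> i < j \<or> i = j \<and> antilex \<beta> \<alpha>"
proof (cases "i = j")
  case True
  have 0: "Poly_Mapping.lookup \<alpha> k = 0 \<and> Poly_Mapping.lookup \<beta> k = 0" if "k \<notin> {1..i - 1}" for k
    using lookup_eq_0_if_keys[OF assms(1)] lookup_eq_0_if_keys[OF assms(2)] True that by blast
  have "antilex \<beta> \<alpha> \<longleftrightarrow> (\<exists>m\<in>{1..i-1}. Poly_Mapping.lookup \<alpha> m > Poly_Mapping.lookup \<beta> m \<and>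
      (\<forall>k. m < k \<and> k \<le> i - 1 \<longrightarrow> Poly_Mapping.lookup \<alpha> k = Poly_Mapping.lookup \<beta> k))"
    (is "_ \<longleftrightarrow> ?R")
  proof
    assume "antilex \<beta> \<alpha>"
    then obtain m where m: "Poly_Mapping.lookup \<beta> m < Poly_Mapping.lookup \<alpha> m"
      "\<forall>k>m. Poly_Mapping.lookup \<beta> k = Poly_Mapping.lookup \<alpha> k"
      unfolding antilex_def by blast
    moreover have "m \<in> {1..i - 1}"
      using m(1) 0[of m] by (metis less_irrefl)
    ultimately show ?R by auto
  next
    assume ?R
    then obtain m where m: "m \<in> {1..i - 1}" "Poly_Mapping.lookup \<beta> m < Poly_Mapping.lookup \<alpha> m"
      "\<forall>k. m < k \<and> k \<le> i - 1 \<longrightarrow> Poly_Mapping.lookup \<alpha> k = Poly_Mapping.lookup \<beta> k"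
      by blast
    then have "\<forall>k>m. Poly_Mapping.lookup \<beta> k = Poly_Mapping.lookup \<alpha> k"
      using 0 by (metis atLeastAtMost_iff)
    with m(2) show "antilex \<beta> \<alpha>"
      unfolding antilex_def by blast
  qed
  then show ?thesis
    using True by (simp add: index_greater_def)
qed (simp add: index_greater_def)

lemma basis_index_Suc:
  "basis_index (Suc n) = (\<lambda>\<alpha>. (\<alpha>, Suc n)) ` {\<alpha>. Poly_Mapping.keys \<alpha> \<subseteq> {1..<1 + n}} \<union> basis_index n"
proof -
  have "{1..<1 + n} = {1..n}" by auto
  then show ?thesis
    by (auto simp: basis_index_def le_Suc_eq)
qed

text \<open>
  Passing from \<open>n\<close> to \<open>n + 1\<close> places the new block \<open>\<nat>\<^sup>n\<close> of \<open>\<partial>\<^bsub>n+1\<^esub>\<close> below the existing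
  basis, in agreement with \<open>\<omega>\<^sup>n\<close> being added on the left.
\<close>

lemma omega_sum_index_order: "rep_ordinal (omega_sum n :: 'b::infinite ordinal) =o index_order n"
proof (induction n)
  case 0
  have "index_order 0 = {}"
    by (auto simp: index_order_def basis_index_def)
  then show ?case
    by (simp add: rep_ordinal_0)
next
  case (Suc n)
  let ?r = "wo_sum (exp_order 1 n) (index_order n)"
  let ?f = "case_sum (\<lambda>\<alpha>. (\<alpha>, Suc n)) (\<lambda>z. z)"
  have wo: "Well_order (exp_order 1 n)" "Well_order (index_order n)"
    using omega_power_exp_order[of n 1] Suc by (auto simp: ordIso_def)
  have le: "snd z \<le> n" if "z \<in> basis_index n" for z
    using that by (auto simp: basis_index_def)
  have "?r =o index_order (Suc n)"
  proof (rule ordIsoI[where f = ?f])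
    show "Well_order ?r"
      by (rule Well_order_wo_sum[OF wo])
    show "inj_on ?f (Field ?r)"
      unfolding Field_wo_sum Field_index_order
      by (rule inj_onI) (auto dest: le)
    show "Field (index_order (Suc n)) = ?f ` Field ?r"
      unfolding Field_wo_sum Field_index_order Field_exp_order basis_index_Suc
      by (simp add: Plus_def image_Un image_image)
    show "(?f u, ?f v) \<in> index_order (Suc n) \<longleftrightarrow> (u, v) \<in> ?r"
      if u: "u \<in> Field ?r" and v: "v \<in> Field ?r" for u v
    proof -
      have top: "(\<alpha>, Suc n) \<in> basis_index (Suc n)" "Poly_Mapping.keys \<alpha> \<subseteq> {1..Suc n - 1}"
        if "\<alpha> \<in> Field (exp_order 1 n)" for \<alpha>
        using that by (force simp: Field_exp_order basis_index_def)+
      have low: "z \<in> basis_index (Suc n)" if "z \<in> basis_index n" for z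
        using that by (simp add: basis_index_Suc)
      have gt: "index_greater z (\<alpha>, Suc n)" "\<not> index_greater (\<alpha>, Suc n) z" if "z \<in> basis_index n" for z \<alpha>
        using le[OF that] by (cases z; simp add: index_greater_def)+
      show ?thesis
      proof (cases u)
        case [simp]: (Inl \<alpha>)
        have \<alpha>: "\<alpha> \<in> Field (exp_order 1 n)"
          using u by (auto simp: Field_wo_sum)
        show ?thesis
        proof (cases v)
          case [simp]: (Inl \<beta>)
          have \<beta>: "\<beta> \<in> Field (exp_order 1 n)"
            using v by (auto simp: Field_wo_sum)
          have "(?f u, ?f v) \<in> index_order (Suc n) \<longleftrightarrow> \<alpha> = \<beta> \<or> antilex \<alpha> \<beta>"
            using top(1)[OF \<alpha>] top(1)[OF \<beta>] index_greater_iff[OF top(2)[OF \<beta>] top(2)[OF \<alpha>]]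
            by (simp add: index_order_def)
          also have "\<dots> \<longleftrightarrow> (u, v) \<in> ?r"
            using \<alpha> \<beta> unfolding Field_exp_order by (simp add: wo_sum_def exp_order_def)
          finally show ?thesis .
        next
          case [simp]: (Inr z)
          have z: "z \<in> basis_index n"
            using v by (auto simp: Field_wo_sum Field_index_order)
          show ?thesis
            using \<alpha> z top(1)[OF \<alpha>] low[OF z] gt(1)[OF z]
            by (cases z) (simp add: wo_sum_def Field_index_order, simp add: index_order_def)
        qed
      next
        case [simp]: (Inr y)
        have y: "y \<in> basis_index n"
          using u by (auto simp: Field_wo_sum Field_index_order)
        show ?thesis
        proof (cases v)
          case [simp]: (Inl \<beta>)
          show ?thesis
            using gt(2)[OF y, of \<beta>] le[OF y] by (auto simp: index_order_def wo_sum_def)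
        next
          case [simp]: (Inr z)
          have z: "z \<in> basis_index n"
            using v by (auto simp: Field_wo_sum Field_index_order)
          show ?thesis
            using low[OF y] low[OF z] y z by (cases y; cases z) (simp add: index_order_def wo_sum_def)
        qed
      qed
    qed
  qed
  moreover have "rep_ordinal (omega_sum (Suc n) :: 'b ordinal) =o ?r"
    unfolding omega_sum.simps
    by (rule ordIso_transitive[OF rep_ordinal_plus wo_sum_cong[OF omega_power_exp_order Suc]])
  ultimately show ?case
    by (metis ordIso_transitive)
qed

section \<open>Polynomials and partial derivatives\<close>

lemma sum_single_lookup: "(\<Sum>\<alpha>\<in>Poly_Mapping.keys p. Poly_Mapping.single \<alpha> (Poly_Mapping.lookup p \<alpha>)) = p"
  by (rule poly_mapping_eqI) (simp add: lookup_sum lookup_single when_def in_keys_iff)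

text \<open>
  Statements that are additive in a polynomial need to be checked on terms only.
\<close>

lemma poly_mapping_add_induct [case_names single add]:
  fixes p :: "'a \<Rightarrow>\<^sub>0 'b::comm_monoid_add"
  assumes "\<And>\<alpha> c. P (Poly_Mapping.single \<alpha> c)" and "\<And>p q. P p \<Longrightarrow> P q \<Longrightarrow> P (p + q)"
  shows "P p"
proof -
  have "P (\<Sum>\<alpha>\<in>A. Poly_Mapping.single \<alpha> (Poly_Mapping.lookup p \<alpha>))" if "finite A" for A
    using that by induction (use assms(1)[of undefined 0] in \<open>auto intro: assms\<close>)
  then show ?thesis
    using sum_single_lookup[of p] by (metis finite_keys)
qed

lemma lookup_single_mult:
  fixes p :: "'a::cancel_comm_monoid_add \<Rightarrow>\<^sub>0 'k::comm_semiring_1"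
  shows "Poly_Mapping.lookup (Poly_Mapping.single \<gamma> c * p) (\<gamma> + \<delta>) = c * Poly_Mapping.lookup p \<delta>"
  by (induction p rule: poly_mapping_add_induct)
    (auto simp: mult_single lookup_single when_def distrib_left lookup_add)

text \<open>
  Since only one term of \<open>p\<close> contributes to a given coefficient of \<open>\<partial>\<^sub>i p\<close>, additivity of \<open>\<partial>\<^sub>i\<close> and
  commutation of partial derivatives can be read off coefficientwise.
\<close>

lemma lookup_partial_deriv:
  "Poly_Mapping.lookup (partial_deriv i p) \<beta> =
    of_nat (Suc (Poly_Mapping.lookup \<beta> i)) * Poly_Mapping.lookup p (\<beta> + Poly_Mapping.single i 1)"
proof -
  let ?e = "Poly_Mapping.single i 1 :: nat \<Rightarrow>\<^sub>0 nat"
  have eq: "\<alpha> - ?e = \<beta> \<longleftrightarrow> \<alpha> = \<beta> + ?e" if "Poly_Mapping.lookup \<alpha> i \<noteq> 0" for \<alpha>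
  proof -
    have "\<alpha> - ?e + ?e = \<alpha>"
      using that by (intro poly_mapping_eqI) (auto simp: lookup_add lookup_minus lookup_single when_def)
    then show ?thesis by auto
  qed
  have "Poly_Mapping.lookup (partial_deriv i p) \<beta> = (\<Sum>\<alpha>\<in>Poly_Mapping.keys p.
      of_nat (Poly_Mapping.lookup \<alpha> i) * Poly_Mapping.lookup p \<alpha> when \<alpha> - ?e = \<beta>)"
    by (simp add: partial_deriv_def lookup_sum lookup_single)
  also have "\<dots> = (\<Sum>\<alpha>\<in>Poly_Mapping.keys p.
      if \<alpha> = \<beta> + ?e then of_nat (Poly_Mapping.lookup \<alpha> i) * Poly_Mapping.lookup p \<alpha> else 0)"
  proof (rule sum.cong)
    fix \<alpha> assume "\<alpha> \<in> Poly_Mapping.keys p"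
    show "(of_nat (Poly_Mapping.lookup \<alpha> i) * Poly_Mapping.lookup p \<alpha> when \<alpha> - ?e = \<beta>) =
      (if \<alpha> = \<beta> + ?e then of_nat (Poly_Mapping.lookup \<alpha> i) * Poly_Mapping.lookup p \<alpha> else 0)"
      using eq[of \<alpha>] by (cases "Poly_Mapping.lookup \<alpha> i = 0") (auto simp: when_def)
  qed simp
  also have "\<dots> = of_nat (Suc (Poly_Mapping.lookup \<beta> i)) * Poly_Mapping.lookup p (\<beta> + ?e)"
    by (auto simp: lookup_add in_keys_iff)
  finally show ?thesis .
qed

lemma keys_partial_deriv:
  "\<beta> \<in> Poly_Mapping.keys (partial_deriv i p) \<Longrightarrow> \<beta> + Poly_Mapping.single i 1 \<in> Poly_Mapping.keys p"
  by (metis in_keys_iff lookup_partial_deriv mult_zero_right)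

lemma partial_deriv_add: "partial_deriv i (p + q) = partial_deriv i p + partial_deriv i q"
  by (rule poly_mapping_eqI) (simp add: lookup_partial_deriv lookup_add distrib_left)

lemma partial_deriv_0 [simp]: "partial_deriv i 0 = 0"
  by (simp add: partial_deriv_def)

lemma partial_deriv_commute: "partial_deriv i (partial_deriv j p) = partial_deriv j (partial_deriv i p)"
  by (cases "i = j"; intro poly_mapping_eqI)
    (simp_all add: lookup_partial_deriv lookup_add lookup_single ac_simps)

lemma partial_deriv_single: "partial_deriv i (Poly_Mapping.single \<alpha> c) =
    Poly_Mapping.single (\<alpha> - Poly_Mapping.single i 1) (of_nat (Poly_Mapping.lookup \<alpha> i) * c)"
  by (simp add: partial_deriv_def)

lemma partial_deriv_mult:
  "partial_deriv i (p * q) = partial_deriv i p * q + p * partial_deriv i q"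
proof (induction p rule: poly_mapping_add_induct)
  case (add p p')
  then show ?case by (simp add: algebra_simps partial_deriv_add)
next
  case (single \<alpha> c)
  let ?e = "Poly_Mapping.single i 1 :: nat \<Rightarrow>\<^sub>0 nat"
  have shift: "\<alpha> + \<beta> - ?e = \<alpha> - ?e + \<beta>" if "Poly_Mapping.lookup \<alpha> i \<noteq> 0" for \<alpha> \<beta>
    using that by (intro poly_mapping_eqI) (auto simp: lookup_add lookup_minus lookup_single when_def)
  show ?case
  proof (induction q rule: poly_mapping_add_induct)
    case (add q q')
    then show ?case by (simp add: algebra_simps partial_deriv_add)
  next
    case (single \<beta> d)
    have "partial_deriv i (Poly_Mapping.single \<alpha> c * Poly_Mapping.single \<beta> d) =
        Poly_Mapping.single (\<alpha> + \<beta> - ?e) (of_nat (Poly_Mapping.lookup \<alpha> i) * (c * d)) +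
        Poly_Mapping.single (\<alpha> + \<beta> - ?e) (of_nat (Poly_Mapping.lookup \<beta> i) * (c * d))"
      by (simp add: mult_single partial_deriv_single lookup_add distrib_right single_add)
    also have "Poly_Mapping.single (\<alpha> + \<beta> - ?e) (of_nat (Poly_Mapping.lookup \<alpha> i) * (c * d)) =
        Poly_Mapping.single (\<alpha> - ?e + \<beta>) (of_nat (Poly_Mapping.lookup \<alpha> i) * (c * d))"
      using shift[of \<alpha> \<beta>] by (cases "Poly_Mapping.lookup \<alpha> i = 0") auto
    also have "Poly_Mapping.single (\<alpha> + \<beta> - ?e) (of_nat (Poly_Mapping.lookup \<beta> i) * (c * d)) =
        Poly_Mapping.single (\<alpha> + (\<beta> - ?e)) (of_nat (Poly_Mapping.lookup \<beta> i) * (c * d))"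
      using shift[of \<beta> \<alpha>] by (cases "Poly_Mapping.lookup \<beta> i = 0") (auto simp: ac_simps)
    finally show ?case
      by (simp add: mult_single partial_deriv_single ac_simps)
  qed
qed

lemma pol_mono: "i \<le> j \<Longrightarrow> pol i \<subseteq> pol j"
  by (fastforce simp: pol_def)

lemma pol_0 [simp]: "0 \<in> pol n"
  by (simp add: pol_def)

lemma pol_single: "Poly_Mapping.keys \<alpha> \<subseteq> {1..n} \<Longrightarrow> Poly_Mapping.single \<alpha> c \<in> pol n"
  by (simp add: pol_def)

lemma pol_add: "p \<in> pol n \<Longrightarrow> q \<in> pol n \<Longrightarrow> p + q \<in> pol n"
  using keys_add[of p q] by (fastforce simp: pol_def)

lemma pol_mult: "p \<in> pol n \<Longrightarrow> q \<in> pol n \<Longrightarrow> p * q \<in> pol n"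
  unfolding pol_def
proof (clarsimp, rule ccontr)
  fix \<alpha> j assume p: "\<forall>\<alpha>\<in>Poly_Mapping.keys p. Poly_Mapping.keys \<alpha> \<subseteq> {Suc 0..n}"
    and q: "\<forall>\<alpha>\<in>Poly_Mapping.keys q. Poly_Mapping.keys \<alpha> \<subseteq> {Suc 0..n}"
    and \<alpha>: "\<alpha> \<in> Poly_Mapping.keys (p * q)" "j \<in> Poly_Mapping.keys \<alpha>" "\<not> (Suc 0 \<le> j \<and> j \<le> n)"
  obtain \<beta> \<gamma> where "\<alpha> = \<beta> + \<gamma>" "\<beta> \<in> Poly_Mapping.keys p" "\<gamma> \<in> Poly_Mapping.keys q"
    using \<alpha>(1) keys_mult[of p q] by blast
  then show False
    using keys_add[of \<beta> \<gamma>] \<alpha>(2,3) p q by fastforce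
qed

lemma pol_sum: "(\<And>x. x \<in> A \<Longrightarrow> f x \<in> pol n) \<Longrightarrow> (\<Sum>x\<in>A. f x) \<in> pol n"
  by (induction A rule: infinite_finite_induct) (auto intro: pol_add)

lemma pol_partial_deriv: "p \<in> pol n \<Longrightarrow> partial_deriv i p \<in> pol n"
proof -
  have "Poly_Mapping.keys \<alpha> \<subseteq> Poly_Mapping.keys (\<alpha> + Poly_Mapping.single i 1)" for \<alpha> :: "nat \<Rightarrow>\<^sub>0 nat"
    by (auto simp: in_keys_iff lookup_add)
  then show "p \<in> pol n \<Longrightarrow> partial_deriv i p \<in> pol n"
    unfolding pol_def by (fastforce dest: keys_partial_deriv)
qed

lemma partial_deriv_eq_0:
  assumes "p \<in> pol m" "m < i"
  shows "partial_deriv i p = 0"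
proof -
  have "Poly_Mapping.keys (partial_deriv i p) = {}"
  proof (rule ccontr)
    assume "Poly_Mapping.keys (partial_deriv i p) \<noteq> {}"
    then obtain \<beta> where "\<beta> + Poly_Mapping.single i 1 \<in> Poly_Mapping.keys p"
      using keys_partial_deriv by blast
    moreover have "i \<in> Poly_Mapping.keys (\<beta> + Poly_Mapping.single i 1)"
      by (simp add: in_keys_iff lookup_add)
    ultimately show False
      using assms by (fastforce simp: pol_def)
  qed
  then show ?thesis by simp
qed

text \<open>
  The derivation \<open>f\<^sub>1\<partial>\<^sub>1 + \<dots> + f\<^sub>n\<partial>\<^sub>n\<close> on polynomials in all variables. Its algebraic identities hold
  without restriction to \<open>P\<^sub>n\<close>.
\<close>

definition diff_op :: "nat \<Rightarrow> (nat \<Rightarrow> 'k::comm_semiring_1 mpoly) \<Rightarrow> 'k mpoly \<Rightarrow> 'k mpoly"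
  where "diff_op n f p = (\<Sum>i=1..n. f i * partial_deriv i p)"

lemma diff_op_0 [simp]: "diff_op n f 0 = 0"
  by (simp add: diff_op_def)

lemma diff_op_add: "diff_op n f (p + q) = diff_op n f p + diff_op n f q"
  by (simp add: diff_op_def partial_deriv_add distrib_left sum.distrib)

lemma diff_op_sum: "diff_op n f (\<Sum>x\<in>A. h x) = (\<Sum>x\<in>A. diff_op n f (h x))"
  by (induction A rule: infinite_finite_induct) (simp_all add: diff_op_add)

lemma diff_op_mult: "diff_op n f (p * q) = diff_op n f p * q + p * diff_op n f q"
  by (simp add: diff_op_def partial_deriv_mult distrib_left sum.distrib sum_distrib_left
      sum_distrib_right ac_simps)

lemma diff_op_monomial:
  assumes "m \<in> {1..n}"
  shows "diff_op n (\<lambda>k. if k = m then q else 0) p = q * partial_deriv m p"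
proof -
  have "diff_op n (\<lambda>k. if k = m then q else 0) p = (\<Sum>k=1..n. if k = m then q * partial_deriv k p else 0)"
    unfolding diff_op_def by (intro sum.cong) auto
  then show ?thesis
    using assms by simp
qed

text \<open>
  The coefficients of the Lie bracket of the derivations with coefficients \<open>f\<close> and \<open>g\<close>.
\<close>

definition bracket ::
    "nat \<Rightarrow> (nat \<Rightarrow> 'k::comm_ring_1 mpoly) \<Rightarrow> (nat \<Rightarrow> 'k mpoly) \<Rightarrow> nat \<Rightarrow> 'k mpoly"
  where "bracket n f g k = diff_op n f (g k) - diff_op n g (f k)"

text \<open>
  The second-order terms of the two compositions agree because partial derivatives commute, so
  only the derivatives of the coefficients remain.
\<close>

lemma diff_op_commutator:
  "diff_op n f (diff_op n g p) - diff_op n g (diff_op n f p) = diff_op n (bracket n f g) p"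
proof -
  have expand: "diff_op n f (diff_op n g p) = (\<Sum>k=1..n. diff_op n f (g k) * partial_deriv k p) +
      (\<Sum>k=1..n. \<Sum>i=1..n. g k * f i * partial_deriv i (partial_deriv k p))"
    for f g :: "nat \<Rightarrow> 'a mpoly"
    unfolding diff_op_def[of n g p] diff_op_sum diff_op_mult
    by (simp add: sum.distrib diff_op_def sum_distrib_left mult.assoc)
  have "(\<Sum>k=1..n. \<Sum>i=1..n. g k * f i * partial_deriv i (partial_deriv k p)) =
      (\<Sum>k=1..n. \<Sum>i=1..n. f k * g i * partial_deriv i (partial_deriv k p))"
    by (subst sum.swap) (simp add: partial_deriv_commute mult.commute)
  then show ?thesis
    unfolding expand[of f g] expand[of g f]
    by (simp add: diff_op_def[of n "bracket n f g"] bracket_def left_diff_distrib sum_subtractf)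
qed

section \<open>The centre of a quotient\<close>

text \<open>
  For an ideal \<open>I\<close> of an algebra with biadditive product, the product of the cosets of \<open>x\<close> and \<open>y\<close>
  is the coset of \<open>x \<otimes> y\<close>, as \<open>(i + x) \<otimes> (j + y)\<close> differs from \<open>x \<otimes> y\<close> by an element of \<open>I\<close>.
\<close>

lemma centre_preimage_eq:
  fixes L (structure)
  assumes "abelian_group L" and I: "additive_subgroup I L"
    and closed: "\<And>x y. x \<in> carrier L \<Longrightarrow> y \<in> carrier L \<Longrightarrow> x \<otimes> y \<in> carrier L"
    and l: "\<And>x y z. x \<in> carrier L \<Longrightarrow> y \<in> carrier L \<Longrightarrow> z \<in> carrier L \<Longrightarrow> (x \<oplus> y) \<otimes> z = x \<otimes> z \<oplus> y \<otimes> z"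
    and r: "\<And>x y z. x \<in> carrier L \<Longrightarrow> y \<in> carrier L \<Longrightarrow> z \<in> carrier L \<Longrightarrow> x \<otimes> (y \<oplus> z) = x \<otimes> y \<oplus> x \<otimes> z"
    and Il: "\<And>x y. x \<in> I \<Longrightarrow> y \<in> carrier L \<Longrightarrow> x \<otimes> y \<in> I"
    and Ir: "\<And>x y. x \<in> carrier L \<Longrightarrow> y \<in> I \<Longrightarrow> x \<otimes> y \<in> I"
  shows "centre_preimage L I = {x \<in> carrier L. \<forall>y \<in> carrier L. x \<otimes> y \<in> I}"
proof -
  interpret abelian_group L by fact
  interpret abelian_subgroup I L
    by (rule abelian_subgroupI3) fact+
  have IL: "x \<in> carrier L" if "x \<in> I" for x
    using that a_subset by blast
  have mult: "rcoset_mult L I (I +> x) (I +> y) = I +> (x \<otimes> y)"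
    if x: "x \<in> carrier L" and y: "y \<in> carrier L" for x y
  proof -
    have "I +> (a \<otimes> b) = I +> (x \<otimes> y)" if a: "a \<in> I +> x" and b: "b \<in> I +> y" for a b
    proof -
      obtain i where i: "i \<in> I" "a = i \<oplus> x"
        using a by (auto simp: a_r_coset_def')
      obtain j where j: "j \<in> I" "b = j \<oplus> y"
        using b by (auto simp: a_r_coset_def')
      have "a \<otimes> b = (i \<otimes> (j \<oplus> y) \<oplus> x \<otimes> j) \<oplus> x \<otimes> y"
        using i j x y IL by (simp add: l r closed a_ac)
      moreover have "i \<otimes> (j \<oplus> y) \<oplus> x \<otimes> j \<in> I"
        using i j x y IL by (intro additive_subgroup.a_closed[OF I] Il Ir) auto
      ultimately have "a \<otimes> b \<in> I +> (x \<otimes> y)"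
        using a_rcosI[of "i \<otimes> (j \<oplus> y) \<oplus> x \<otimes> j" I "x \<otimes> y"] a_subset closed[OF x y] by simp
      then show ?thesis
        using a_repr_independence' closed[OF x y] by metis
    qed
    moreover have "I +> x \<noteq> {}" "I +> y \<noteq> {}"
      using a_rcos_self x y by blast+
    ultimately show ?thesis
      unfolding rcoset_mult_def by (simp cong: SUP_cong)
  qed
  have coset: "I +> x = I \<longleftrightarrow> x \<in> I" if "x \<in> carrier L" for x
    using that a_rcos_const a_rcos_self by blast
  have "I +> x \<in> lie_centre (L Quot I) \<longleftrightarrow> (\<forall>y \<in> carrier L. x \<otimes> y \<in> I)"
    if x: "x \<in> carrier L" for x
  proof -
    have "I +> x \<in> lie_centre (L Quot I) \<longleftrightarrow>
        (\<forall>y \<in> carrier L. rcoset_mult L I (I +> x) (I +> y) = I)"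
      unfolding lie_centre_def FactRing_def A_RCOSETS_def' using x by auto
    then show ?thesis
      using x by (simp add: mult coset closed)
  qed
  then show ?thesis
    unfolding centre_preimage_def by blast
qed

section \<open>Triangular derivations and their coefficients\<close>

definition tri_der :: "nat \<Rightarrow> (nat \<Rightarrow> 'k::field mpoly) \<Rightarrow> 'k mpoly \<Rightarrow> 'k mpoly"
  where "tri_der n f = (\<lambda>p\<in>pol n. diff_op n f p)"

text \<open>
  Only the coefficients with index in \<open>{1..n}\<close> count, so that the support depends on the derivation
  alone and not on the coefficient function that represents it.
\<close>

definition support :: "nat \<Rightarrow> (nat \<Rightarrow> 'k::zero mpoly) \<Rightarrow> ((nat \<Rightarrow>\<^sub>0 nat) \<times> nat) set"
  where "support n f = {(\<alpha>, i). i \<in> {1..n} \<and> \<alpha> \<in> Poly_Mapping.keys (f i)}"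

text \<open>
  For \<open>J \<subseteq> basis_index n\<close> this is the span of the basis elements with index in \<open>J\<close>. For other \<open>J\<close>
  the coefficient \<open>f\<^sub>i\<close> need not lie in \<open>P\<^bsub>i-1\<^esub>\<close>.
\<close>

definition supported :: "nat \<Rightarrow> ((nat \<Rightarrow>\<^sub>0 nat) \<times> nat) set \<Rightarrow> ('k::field mpoly \<Rightarrow> 'k mpoly) set"
  where "supported n J = tri_der n ` {f. support n f \<subseteq> J}"

lemma support_eq_swap: "support n f = prod.swap ` Sigma {1..n} (\<lambda>i. Poly_Mapping.keys (f i))"
  by (auto simp: support_def)

lemma finite_support: "finite (support n f)"
  unfolding support_eq_swap by simp

lemma support_subset_basis_index:
  "support n f \<subseteq> basis_index n \<longleftrightarrow> (\<forall>i\<in>{1..n}. f i \<in> pol (i - 1))"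
  by (fastforce simp: support_def basis_index_def pol_def)

lemma carrier_tri: "carrier (tri n) = supported n (basis_index n)"
  unfolding supported_def support_subset_basis_index
  unfolding tri_def tri_der_def diff_op_def by (simp add: image_Collect)

lemma zero_tri: "\<zero>\<^bsub>tri n\<^esub> = tri_der n (\<lambda>_. 0)"
  by (simp add: tri_def Der_def tri_der_def diff_op_def)

lemma add_tri: "tri_der n f \<oplus>\<^bsub>tri n\<^esub> tri_der n g = tri_der n (\<lambda>i. f i + g i)"
  by (auto simp: tri_def Der_def tri_der_def diff_op_def distrib_right sum.distrib)

lemma smult_tri: "c \<odot>\<^bsub>tri n\<^esub> tri_der n f = tri_der n (\<lambda>i. const c * f i)"
  by (auto simp: tri_def Der_def tri_der_def diff_op_def sum_distrib_left mult.assoc)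

lemma pol_diff_op:
  assumes "support n f \<subseteq> basis_index n" "p \<in> pol n"
  shows "diff_op n f p \<in> pol n"
  unfolding diff_op_def
proof (intro pol_sum pol_mult pol_partial_deriv)
  show "f i \<in> pol n" if "i \<in> {1..n}" for i
  proof (rule subsetD[OF pol_mono])
    show "f i \<in> pol (i - 1)"
      using assms(1) that unfolding support_subset_basis_index by blast
  qed (use that in auto)
qed (rule assms)

lemma mult_tri:
  assumes "support n f \<subseteq> basis_index n" "support n g \<subseteq> basis_index n"
  shows "tri_der n f \<otimes>\<^bsub>tri n\<^esub> tri_der n g = tri_der n (bracket n f g)"
  unfolding tri_def Der_def tri_der_def
  using assms[THEN pol_diff_op] diff_op_commutator[of n f g] by (auto intro!: restrict_ext)

lemma partial_deriv_xpow: "partial_deriv i (xpow \<alpha>) =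
    Poly_Mapping.single (\<alpha> - Poly_Mapping.single i 1) (of_nat (Poly_Mapping.lookup \<alpha> i))"
  by (simp add: xpow_def partial_deriv_single)

lemma xpow_in_pol: "Poly_Mapping.keys \<alpha> \<subseteq> {1..n} \<Longrightarrow> xpow \<alpha> \<in> pol n"
  by (simp add: xpow_def pol_single)

text \<open>
  The coefficients of a derivation are its values on the variables, hence are unique.
\<close>

lemma tri_der_variable:
  assumes "k \<in> {1..n}"
  shows "tri_der n f (xpow (Poly_Mapping.single k 1)) = f k"
proof -
  have "partial_deriv i (xpow (Poly_Mapping.single k 1)) = (if i = k then 1 else 0 :: 'a mpoly)" for i
    by (simp add: partial_deriv_xpow lookup_single when_def)
  then have "diff_op n f (xpow (Poly_Mapping.single k 1)) = (\<Sum>i=1..n. if i = k then f k else 0)"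
    unfolding diff_op_def by (intro sum.cong) auto
  moreover have "(xpow (Poly_Mapping.single k 1) :: 'a mpoly) \<in> pol n"
    using assms by (intro xpow_in_pol) auto
  ultimately show ?thesis
    using assms by (simp add: tri_der_def)
qed

lemma tri_der_eq_iff: "tri_der n f = tri_der n g \<longleftrightarrow> (\<forall>i\<in>{1..n}. f i = g i)"
proof
  show "\<forall>i\<in>{1..n}. f i = g i" if "tri_der n f = tri_der n g"
    using that tri_der_variable by metis
  show "tri_der n f = tri_der n g" if "\<forall>i\<in>{1..n}. f i = g i"
    using that by (simp add: tri_der_def diff_op_def)
qed

lemma tri_der_supported_iff: "tri_der n f \<in> supported n J \<longleftrightarrow> support n f \<subseteq> J"
proof -
  have "support n f = support n g" if "tri_der n f = tri_der n g" for g :: "nat \<Rightarrow> 'a mpoly"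
    using that by (auto simp: support_def tri_der_eq_iff)
  then show ?thesis
    unfolding supported_def by blast
qed

lemma support_0 [simp]: "support n (\<lambda>_. 0) = {}"
  by (simp add: support_def)

lemma support_add: "support n (\<lambda>i. f i + g i) \<subseteq> support n f \<union> support n g"
  using keys_add by (fastforce simp: support_def)

lemma support_uminus: "support n (\<lambda>i. - f i :: 'k::ab_group_add mpoly) = support n f"
  by (simp add: support_def in_keys_iff)

lemma supportedE:
  assumes "D \<in> supported n J"
  obtains f where "D = tri_der n f" "support n f \<subseteq> J"
  using assms by (auto simp: supported_def)

lemma supported_mono: "J \<subseteq> J' \<Longrightarrow> supported n J \<subseteq> supported n J'"
  by (auto simp: supported_def)

lemma supported_add:
  assumes "D \<in> supported n J" "E \<in> supported n J"
  shows "D \<oplus>\<^bsub>tri n\<^esub> E \<in> supported n J"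
proof -
  obtain f g where "D = tri_der n f" "E = tri_der n g" "support n f \<subseteq> J" "support n g \<subseteq> J"
    using assms by (metis supportedE)
  then show ?thesis
    using support_add[of n f g] by (auto simp: add_tri tri_der_supported_iff)
qed

lemma supported_zero: "\<zero>\<^bsub>tri n\<^esub> \<in> supported n J"
  by (simp add: zero_tri tri_der_supported_iff)

lemma supported_uminus:
  assumes "D \<in> supported n J"
  shows "\<exists>E\<in>supported n J. E \<oplus>\<^bsub>tri n\<^esub> D = \<zero>\<^bsub>tri n\<^esub>"
proof -
  obtain f where f: "D = tri_der n f" "support n f \<subseteq> J"
    using assms by (rule supportedE)
  then have "tri_der n (\<lambda>i. - f i) \<in> supported n J"
    by (simp add: tri_der_supported_iff support_uminus)
  moreover have "tri_der n (\<lambda>i. - f i) \<oplus>\<^bsub>tri n\<^esub> D = \<zero>\<^bsub>tri n\<^esub>"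
    by (simp add: f add_tri zero_tri)
  ultimately show ?thesis by blast
qed

lemma abelian_group_tri: "abelian_group (tri n)"
proof (rule abelian_groupI)
  show "x \<oplus>\<^bsub>tri n\<^esub> y \<oplus>\<^bsub>tri n\<^esub> z = x \<oplus>\<^bsub>tri n\<^esub> (y \<oplus>\<^bsub>tri n\<^esub> z)"
    if "x \<in> carrier (tri n)" "y \<in> carrier (tri n)" "z \<in> carrier (tri n)" for x y z :: "'a mpoly \<Rightarrow> 'a mpoly"
    using that unfolding carrier_tri by (auto elim!: supportedE simp: add_tri add.assoc)
  show "x \<oplus>\<^bsub>tri n\<^esub> y = y \<oplus>\<^bsub>tri n\<^esub> x"
    if "x \<in> carrier (tri n)" "y \<in> carrier (tri n)" for x y :: "'a mpoly \<Rightarrow> 'a mpoly"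
    using that unfolding carrier_tri by (auto elim!: supportedE simp: add_tri add.commute)
  show "\<zero>\<^bsub>tri n\<^esub> \<oplus>\<^bsub>tri n\<^esub> x = x" if "x \<in> carrier (tri n)" for x :: "'a mpoly \<Rightarrow> 'a mpoly"
    using that unfolding carrier_tri by (auto elim!: supportedE simp: add_tri zero_tri)
qed (simp_all add: carrier_tri supported_add supported_zero supported_uminus)

lemma additive_subgroup_supported:
  assumes "J \<subseteq> basis_index n"
  shows "additive_subgroup (supported n J) (tri n)"
proof -
  interpret abelian_group "tri n" by (rule abelian_group_tri)
  have sub: "supported n J \<subseteq> carrier (tri n)"
    unfolding carrier_tri by (rule supported_mono[OF assms])
  show ?thesis
  proof (intro additive_subgroupI add.subgroupI)
    show "\<ominus>\<^bsub>tri n\<^esub> D \<in> supported n J" if D: "D \<in> supported n J" for D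
    proof -
      obtain E where E: "E \<in> supported n J" "E \<oplus>\<^bsub>tri n\<^esub> D = \<zero>\<^bsub>tri n\<^esub>"
        using supported_uminus[OF D] by blast
      then have "\<ominus>\<^bsub>tri n\<^esub> D = E"
        using D sub by (intro minus_equality) auto
      then show ?thesis
        using E by simp
    qed
    show "supported n J \<noteq> {}"
      by (rule iffD1[OF ex_in_conv]) (rule exI, rule supported_zero)
  qed (use sub supported_add in auto)
qed

section \<open>Spans of basis elements\<close>

lemma basis_elt_eq: "basis_elt n \<alpha> i = tri_der n (\<lambda>k. if k = i then xpow \<alpha> else 0)" if "i \<in> {1..n}"
  using that by (simp add: basis_elt_def tri_der_def diff_op_monomial)

lemma finsum_tri_der:
  assumes "finite A" "\<And>x. x \<in> A \<Longrightarrow> support n (h x) \<subseteq> basis_index n"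
  shows "(\<Oplus>\<^bsub>tri n\<^esub>x\<in>A. tri_der n (h x)) = tri_der n (\<lambda>i. \<Sum>x\<in>A. h x i)"
proof -
  interpret abelian_group "tri n" by (rule abelian_group_tri)
  have "tri_der n (h x) \<in> carrier (tri n)" if "x \<in> A" for x
    unfolding carrier_tri tri_der_supported_iff by (rule assms(2)[OF that])
  with assms(1) show ?thesis
    by (induction A) (simp_all add: zero_tri add_tri Pi_def)
qed

lemma support_single:
  "support n (\<lambda>k. if k = i then Poly_Mapping.single \<alpha> c else 0) \<subseteq> {(\<alpha>, i)}"
  by (auto simp: support_def split: if_splits)

lemma smult_basis_elt:
  assumes "i \<in> {1..n}"
  shows "c \<odot>\<^bsub>tri n\<^esub> basis_elt n \<alpha> i = tri_der n (\<lambda>k. if k = i then Poly_Mapping.single \<alpha> c else 0)"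
  using assms unfolding basis_elt_eq[OF assms] smult_tri tri_der_eq_iff
  by (simp add: const_def xpow_def mult_single)

lemma basis_index_snd: "z \<in> basis_index n \<Longrightarrow> snd z \<in> {1..n}"
  by (auto simp: basis_index_def)

lemma inj_on_basis_elt:
  "inj_on (\<lambda>(\<alpha>, i). basis_elt n \<alpha> i :: 'k::field mpoly \<Rightarrow> 'k mpoly) (basis_index n)"
proof (rule inj_onI)
  fix y z assume y: "y \<in> basis_index n" and z: "z \<in> basis_index n"
    and eq: "(\<lambda>(\<alpha>, i). basis_elt n \<alpha> i :: 'k mpoly \<Rightarrow> 'k mpoly) y = (\<lambda>(\<alpha>, i). basis_elt n \<alpha> i) z"
  obtain \<alpha> i \<beta> j where [simp]: "y = (\<alpha>, i)" "z = (\<beta>, j)"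
    by (cases y, cases z)
  have i: "i \<in> {1..n}" "j \<in> {1..n}"
    using basis_index_snd[OF y] basis_index_snd[OF z] by auto
  have "\<forall>k\<in>{1..n}. (if k = i then xpow \<alpha> else 0 :: 'k mpoly) = (if k = j then xpow \<beta> else 0)"
    using eq by (simp add: basis_elt_eq[OF i(1)] basis_elt_eq[OF i(2)] tri_der_eq_iff)
  from bspec[OF this i(1)] have "(if i = j then xpow \<beta> else 0 :: 'k mpoly) = xpow \<alpha>"
    by simp
  moreover have "Poly_Mapping.keys (xpow \<alpha> :: 'k mpoly) = {\<alpha>}"
    by (simp add: xpow_def)
  then have "xpow \<alpha> \<noteq> (0 :: 'k mpoly)"
    by auto
  ultimately have "i = j" "Poly_Mapping.single \<beta> (1::'k) = Poly_Mapping.single \<alpha> 1"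
    by (auto simp: xpow_def split: if_splits)
  then show "y = z"
    by (metis \<open>y = (\<alpha>, i)\<close> \<open>z = (\<beta>, j)\<close> keys_single singleton_inject zero_neq_one)
qed

text \<open>
  A derivation is the sum over its support of the terms \<open>c x\<^sup>\<alpha>\<partial>\<^sub>i\<close> of its coefficients. The scalar
  belonging to a basis element is found by inverting the injective indexing of the basis.
\<close>

lemma lin_span_basis:
  assumes J: "J \<subseteq> basis_index n"
  shows "lin_span (tri n) ((\<lambda>(\<alpha>, i). basis_elt n \<alpha> i :: 'k::field mpoly \<Rightarrow> 'k mpoly) ` J) = supported n J"
    (is "lin_span ?L (?b ` J) = _")
proof (intro equalityI subsetI)
  interpret abelian_group ?L by (rule abelian_group_tri)
  interpret S: additive_subgroup "supported n J" ?L
    by (rule additive_subgroup_supported[OF J])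
  have term_in: "c \<odot>\<^bsub>?L\<^esub> ?b z = tri_der n (\<lambda>k. if k = snd z then Poly_Mapping.single (fst z) c else 0)"
    "c \<odot>\<^bsub>?L\<^esub> ?b z \<in> supported n J" if "z \<in> J" for c z
  proof -
    have i: "snd z \<in> {1..n}"
      using that J basis_index_snd by blast
    then show eq: "c \<odot>\<^bsub>?L\<^esub> ?b z = tri_der n (\<lambda>k. if k = snd z then Poly_Mapping.single (fst z) c else 0)"
      by (simp add: smult_basis_elt split_beta)
    show "c \<odot>\<^bsub>?L\<^esub> ?b z \<in> supported n J"
      unfolding eq tri_der_supported_iff using support_single[of n "snd z" "fst z" c] that by auto
  qed
  {
    fix D assume "D \<in> lin_span ?L (?b ` J)"
    then obtain c F where D: "D = (\<Oplus>\<^bsub>?L\<^esub>x\<in>F. c x \<odot>\<^bsub>?L\<^esub> x)" "finite F" "F \<subseteq> ?b ` J"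
      unfolding lin_span_def by blast
    have "\<And>x. x \<in> F \<Longrightarrow> c x \<odot>\<^bsub>?L\<^esub> x \<in> supported n J"
      using D(3) term_in(2) by blast
    with \<open>finite F\<close> have "(\<Oplus>\<^bsub>?L\<^esub>x\<in>F. c x \<odot>\<^bsub>?L\<^esub> x) \<in> supported n J"
    proof (induction F)
      case (insert x F)
      have "c x \<odot>\<^bsub>?L\<^esub> x \<in> carrier ?L" "(\<lambda>x. c x \<odot>\<^bsub>?L\<^esub> x) \<in> F \<rightarrow> carrier ?L"
        using insert.prems S.a_subset by auto
      then show ?case
        using insert by (simp add: supported_add)
    qed (simp add: supported_zero)
    then show "D \<in> supported n J"
      using D(1) by simp
  next
    fix D :: "'k mpoly \<Rightarrow> 'k mpoly" assume "D \<in> supported n J"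
    then obtain f where f: "D = tri_der n f" "support n f \<subseteq> J"
      by (rule supportedE)
    let ?c = "\<lambda>z. Poly_Mapping.lookup (f (snd z)) (fst z)"
    let ?h = "\<lambda>z k. if k = snd z then Poly_Mapping.single (fst z) (?c z) else 0"
    have fin: "finite (support n f)"
      by (rule finite_support)
    have sub: "support n f \<subseteq> basis_index n"
      using f(2) J by blast
    have "f i = (\<Sum>z\<in>support n f. ?h z i)" if i: "i \<in> {1..n}" for i
    proof -
      have "(\<Sum>z\<in>support n f. ?h z i) =
          (\<Sum>k=1..n. \<Sum>\<alpha>\<in>Poly_Mapping.keys (f k). ?h (\<alpha>, k) i)"
        unfolding support_eq_swap by (subst sum.reindex) (simp_all add: sum.Sigma split_beta cong: if_cong)
      also have "\<dots> = (\<Sum>k=1..n. if k = i then f i else 0)"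
        by (intro sum.cong) (auto simp: sum_single_lookup)
      finally show ?thesis
        using i by simp
    qed
    then have "D = tri_der n (\<lambda>i. \<Sum>z\<in>support n f. ?h z i)"
      unfolding f(1) tri_der_eq_iff by blast
    also have "\<dots> = (\<Oplus>\<^bsub>?L\<^esub>z\<in>support n f. tri_der n (?h z))"
      using fin sub support_single by (intro finsum_tri_der[symmetric]) fastforce+
    also have "\<dots> = (\<Oplus>\<^bsub>?L\<^esub>z\<in>support n f. ?c z \<odot>\<^bsub>?L\<^esub> ?b z)"
      using f(2) term_in S.a_subset by (intro finsum_cong') (auto simp: Pi_def subset_iff cong: if_cong)
    also have "\<dots> = (\<Oplus>\<^bsub>?L\<^esub>z\<in>support n f. ?c (inv_into (basis_index n) ?b (?b z)) \<odot>\<^bsub>?L\<^esub> ?b z)"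
    proof (rule finsum_cong')
      have inv: "inv_into (basis_index n) ?b (?b z) = z" if "z \<in> support n f" for z
        using inv_into_f_f[OF inj_on_basis_elt] that sub by blast
      show "?c z \<odot>\<^bsub>?L\<^esub> ?b z = ?c (inv_into (basis_index n) ?b (?b z)) \<odot>\<^bsub>?L\<^esub> ?b z"
        if "z \<in> support n f" for z
        by (simp only: inv[OF that])
      show "(\<lambda>z. ?c (inv_into (basis_index n) ?b (?b z)) \<odot>\<^bsub>?L\<^esub> ?b z) \<in> support n f \<rightarrow> carrier ?L"
        using f(2) term_in(2) S.a_subset by blast
    qed (rule refl)
    also have "\<dots> = (\<Oplus>\<^bsub>?L\<^esub>x\<in>?b ` support n f. ?c (inv_into (basis_index n) ?b x) \<odot>\<^bsub>?L\<^esub> x)"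
    proof (rule finsum_reindex[symmetric])
      show "inj_on ?b (support n f)"
        using inj_on_basis_elt sub by (rule inj_on_subset)
      show "(\<lambda>x. ?c (inv_into (basis_index n) ?b x) \<odot>\<^bsub>?L\<^esub> x) \<in> ?b ` support n f \<rightarrow> carrier ?L"
        using f(2) term_in(2) S.a_subset by (auto simp: Pi_def subset_iff)
    qed
    finally show "D \<in> lin_span ?L (?b ` J)"
      unfolding lin_span_def using fin f(2)
      by (intro CollectI exI[of _ "\<lambda>x. ?c (inv_into (basis_index n) ?b x)"] exI[of _ "?b ` support n f"]) auto
  }
qed

section \<open>Leading terms of brackets\<close>

lemma Well_order_index_order: "Well_order (index_order n)"
  using omega_sum_index_order[where 'b = nat] by (auto simp: ordIso_def)

text \<open>
  Divisibility of monomials is a convenient sufficient condition for not being below: it is the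
  only comparison needed for the brackets constructed later.
\<close>

lemma antilex_not_ge:
  assumes "\<And>k. Poly_Mapping.lookup \<beta> k \<le> Poly_Mapping.lookup \<alpha> k"
  shows "\<not> antilex \<alpha> \<beta>"
  using assms by (auto simp: antilex_def not_less)

lemma basis_indexD:
  "(\<alpha>, i) \<in> basis_index n \<Longrightarrow> Poly_Mapping.keys \<alpha> \<subseteq> {1..i - 1}"
  "(\<alpha>, i) \<in> basis_index n \<Longrightarrow> i \<in> {1..n}"
  by (auto simp: basis_index_def)

lemma index_order_iff:
  assumes "(\<alpha>, i) \<in> basis_index n" "(\<beta>, j) \<in> basis_index n"
  shows "((\<beta>, j), (\<alpha>, i)) \<in> index_order n \<longleftrightarrow> i < j \<or> i = j \<and> (\<alpha> = \<beta> \<or> antilex \<beta> \<alpha>)"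
  using assms index_greater_iff[OF assms[THEN basis_indexD(1)]]
  by (auto simp: index_order_def)

lemma keys_diff_op:
  fixes f :: "nat \<Rightarrow> 'k::field mpoly"
  assumes f: "support n f \<subseteq> basis_index n" and p: "p \<in> pol m" and \<alpha>: "\<alpha> \<in> Poly_Mapping.keys (diff_op n f p)"
  obtains i \<beta> \<delta> where "i \<in> {1..n}" "i \<le> m" "\<alpha> = \<beta> + \<delta>" "(\<beta>, i) \<in> support n f"
    "\<delta> + Poly_Mapping.single i 1 \<in> Poly_Mapping.keys p"
proof -
  obtain i where i: "i \<in> {1..n}" "\<alpha> \<in> Poly_Mapping.keys (f i * partial_deriv i p)"
    using \<alpha> keys_sum[of "\<lambda>i. f i * partial_deriv i p" "{1..n}"] unfolding diff_op_def by blast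
  then obtain \<beta> \<delta> where \<beta>: "\<alpha> = \<beta> + \<delta>" "\<beta> \<in> Poly_Mapping.keys (f i)" "\<delta> \<in> Poly_Mapping.keys (partial_deriv i p)"
    using keys_mult[of "f i" "partial_deriv i p"] by blast
  have "i \<le> m"
    using partial_deriv_eq_0[OF p, of i] \<beta>(3) by (cases "i \<le> m") auto
  show thesis
  proof (rule that)
    show "(\<beta>, i) \<in> support n f"
      using i(1) \<beta>(2) by (simp add: support_def)
  qed (fact i(1) \<open>i \<le> m\<close> \<beta>(1) keys_partial_deriv[OF \<beta>(3)])+
qed

text \<open>
  A monomial of \<open>f\<^sub>i \<partial>\<^sub>i(g\<^sub>k)\<close> has the form \<open>\<beta> + \<delta>\<close> with \<open>\<beta>\<close> from \<open>f\<^sub>i\<close> and \<open>\<delta> + e\<^sub>i\<close> from \<open>g\<^sub>k\<close>, where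
  \<open>i < k\<close>. It is below \<open>(\<beta>, i)\<close> since it belongs to a later block, and below \<open>(\<delta> + e\<^sub>i, k)\<close> since
  position \<open>i\<close> drops by one while \<open>\<beta>\<close> involves only positions before \<open>i\<close>.
\<close>

lemma keys_diff_op_less:
  fixes f g :: "nat \<Rightarrow> 'k::field mpoly"
  assumes f: "support n f \<subseteq> basis_index n" and g: "support n g \<subseteq> basis_index n"
    and k: "k \<in> {1..n}" and \<alpha>: "\<alpha> \<in> Poly_Mapping.keys (diff_op n f (g k))"
  shows "(\<alpha>, k) \<in> basis_index n"
    and "\<exists>y\<in>support n f. (\<alpha>, k) \<in> underS (index_order n) y"
    and "\<exists>y\<in>support n g. (\<alpha>, k) \<in> underS (index_order n) y"
proof -
  have gk: "g k \<in> pol (k - 1)"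
    using g k unfolding support_subset_basis_index by blast
  obtain i \<beta> \<delta> where i: "i \<in> {1..n}" "i \<le> k - 1" "\<alpha> = \<beta> + \<delta>" and \<beta>: "(\<beta>, i) \<in> support n f"
    and \<delta>: "\<delta> + Poly_Mapping.single i 1 \<in> Poly_Mapping.keys (g k)" (is "?\<gamma> \<in> _")
    using keys_diff_op[OF f gk \<alpha>] by blast
  have \<gamma>: "(?\<gamma>, k) \<in> support n g"
    using \<delta> k by (simp add: support_def)
  have bi: "(\<beta>, i) \<in> basis_index n" "(?\<gamma>, k) \<in> basis_index n"
    using \<beta> \<gamma> f g by blast+
  have sub: "Poly_Mapping.keys \<delta> \<subseteq> Poly_Mapping.keys ?\<gamma>"
    by (auto simp: in_keys_iff lookup_add)
  have "Poly_Mapping.keys \<beta> \<subseteq> {1..k - 1}"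
    using basis_indexD(1)[OF bi(1)] i(2) by (auto dest!: subsetD)
  then have "Poly_Mapping.keys \<alpha> \<subseteq> {1..k - 1}"
    using sub basis_indexD(1)[OF bi(2)] keys_add[of \<beta> \<delta>] unfolding i(3) by blast
  then show \<alpha>k: "(\<alpha>, k) \<in> basis_index n"
    using k by (simp add: basis_index_def)
  have "i < k"
    using i(1,2) by auto
  then show "\<exists>y\<in>support n f. (\<alpha>, k) \<in> underS (index_order n) y"
    using \<beta> index_order_iff[OF bi(1) \<alpha>k] by (auto simp: underS_def)
  have "Poly_Mapping.lookup \<beta> j = 0" if "j \<ge> i" for j
    using lookup_eq_0_if_keys[OF basis_indexD(1)[OF bi(1)], of j] that i(1) by auto
  then have "antilex \<alpha> ?\<gamma>"
    unfolding antilex_def i(3) by (intro exI[of _ i]) (auto simp: lookup_add lookup_single when_def)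
  then show "\<exists>y\<in>support n g. (\<alpha>, k) \<in> underS (index_order n) y"
    using \<gamma> index_order_iff[OF bi(2) \<alpha>k] antilex_irrefl[of \<alpha>]
    by (intro bexI[of _ "(?\<gamma>, k)"]) (auto simp: underS_def simp del: One_nat_def)
qed

lemma support_bracket:
  fixes f g :: "nat \<Rightarrow> 'k::field mpoly"
  assumes f: "support n f \<subseteq> basis_index n" and g: "support n g \<subseteq> basis_index n"
    and z: "z \<in> support n (bracket n f g)"
  shows "z \<in> basis_index n"
    and "\<exists>y\<in>support n f. z \<in> underS (index_order n) y"
    and "\<exists>y\<in>support n g. z \<in> underS (index_order n) y"
proof -
  obtain \<alpha> k where \<alpha>: "z = (\<alpha>, k)" "k \<in> {1..n}" "\<alpha> \<in> Poly_Mapping.keys (bracket n f g k)"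
    using z by (auto simp: support_def)
  then have "\<alpha> \<in> Poly_Mapping.keys (diff_op n f (g k)) \<or> \<alpha> \<in> Poly_Mapping.keys (diff_op n g (f k))"
    using keys_diff[of "diff_op n f (g k)" "diff_op n g (f k)"] unfolding bracket_def by blast
  then have "z \<in> basis_index n \<and> (\<exists>y\<in>support n f. z \<in> underS (index_order n) y) \<and>
      (\<exists>y\<in>support n g. z \<in> underS (index_order n) y)"
    unfolding \<alpha>(1) using keys_diff_op_less[OF f g \<alpha>(2)] keys_diff_op_less[OF g f \<alpha>(2)] by blast
  then show "z \<in> basis_index n" "\<exists>y\<in>support n f. z \<in> underS (index_order n) y"
    "\<exists>y\<in>support n g. z \<in> underS (index_order n) y" by blast+
qed

text \<open>
  The witness \<open>g\<close> is a single basis element. In both cases one coefficient of the bracket is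
  computed exactly, at a monomial \<open>\<omega>\<close> of component \<open>j\<close> with \<open>\<beta> \<le> \<omega>\<close> pointwise, and characteristic
  zero keeps it from vanishing.
\<close>

lemma exists_bracket_not_below:
  fixes f :: "nat \<Rightarrow> 'k::field_char_0 mpoly"
  assumes f: "support n f \<subseteq> basis_index n" and z: "z \<in> basis_index n"
    and not_sub: "\<not> support n f \<subseteq> under (index_order n) z"
  obtains g where "support n g \<subseteq> basis_index n" "\<not> support n (bracket n f g) \<subseteq> underS (index_order n) z"
proof -
  obtain \<beta> j where zz: "z = (\<beta>, j)" by (cases z)
  note \<beta>j = z[unfolded zz] and witness = that
  have ge: "(\<omega>, k) \<notin> underS (index_order n) z"
    if "(\<omega>, k) \<in> basis_index n" "k = j" "\<And>l. Poly_Mapping.lookup \<beta> l \<le> Poly_Mapping.lookup \<omega> l" for \<omega> k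
    using index_order_iff[OF \<beta>j that(1)] antilex_not_ge[of \<beta> \<omega>] that zz by (auto simp: underS_def)
  have fpol: "f i \<in> pol (i - 1)" if "i \<in> {1..n}" for i
    using f that unfolding support_subset_basis_index by blast
  have result: thesis
    if m: "m \<in> {1..n}" and \<gamma>: "Poly_Mapping.keys \<gamma> \<subseteq> {1..m - 1}"
      and \<omega>: "Poly_Mapping.lookup (bracket n f (\<lambda>k. if k = m then xpow \<gamma> else 0) j) \<omega> \<noteq> 0"
      and \<omega>_ge: "\<And>l. Poly_Mapping.lookup \<beta> l \<le> Poly_Mapping.lookup \<omega> l" for m \<gamma> \<omega>
  proof (rule witness)
    let ?g = "\<lambda>k. if k = m then xpow \<gamma> else 0 :: 'k mpoly"
    show g: "support n ?g \<subseteq> basis_index n"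
      using m \<gamma> by (auto simp: support_def basis_index_def xpow_def split: if_splits)
    have s: "(\<omega>, j) \<in> support n (bracket n f ?g)"
      using \<omega> basis_indexD(2)[OF \<beta>j] by (simp add: support_def in_keys_iff)
    moreover have "(\<omega>, j) \<notin> underS (index_order n) z"
      using support_bracket(1)[OF f g s] \<omega>_ge by (intro ge) auto
    ultimately show "\<not> support n (bracket n f ?g) \<subseteq> underS (index_order n) z"
      by blast
  qed
  have j: "j \<in> {1..n}"
    by (rule basis_indexD(2)[OF \<beta>j])
  show thesis
  proof (cases "\<exists>i. i \<in> {1..n} \<and> i < j \<and> f i \<noteq> 0")
    case True
    \<comment> \<open>Minimality of \<open>i\<close> excludes contributions of \<open>f\<^sub>l\<close> with \<open>l < i\<close>; those with \<open>l > i\<close> are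
        recognised by their exponent of \<open>x\<^sub>l\<close>, which is that of \<open>x\<^sup>\<beta>\<close> lowered by one.\<close>
    define i where "i = (LEAST i. i \<in> {1..n} \<and> i < j \<and> f i \<noteq> 0)"
    have i: "i \<in> {1..n}" "i < j" "f i \<noteq> 0"
      using LeastI_ex[OF True] unfolding i_def by blast+
    have least: "f l = 0" if "l \<in> {1..n}" "l < i" for l
      using not_less_Least[of l "\<lambda>i. i \<in> {1..n} \<and> i < j \<and> f i \<noteq> 0"] that i(2) unfolding i_def by auto
    obtain \<alpha> where \<alpha>: "\<alpha> \<in> Poly_Mapping.keys (f i)"
      using i(3) by fastforce
    have low: "Poly_Mapping.lookup \<mu> l = 0" if "\<mu> \<in> Poly_Mapping.keys (f k)" "k \<in> {1..n}" "k \<le> l" for \<mu> k l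
    proof (rule lookup_eq_0_if_keys)
      show "Poly_Mapping.keys \<mu> \<subseteq> {1..k - 1}"
        using fpol[OF that(2)] that(1) by (simp add: pol_def)
    qed (use that in auto)
    let ?\<gamma> = "\<beta> + Poly_Mapping.single i 1"
    let ?g = "\<lambda>k. if k = j then xpow ?\<gamma> else 0 :: 'k mpoly"
    let ?p = "xpow ?\<gamma> :: 'k mpoly"
    have "bracket n f ?g j = diff_op n f ?p"
      using partial_deriv_eq_0[OF fpol[OF j], of j] j by (simp add: bracket_def diff_op_monomial)
    also have "Poly_Mapping.lookup \<dots> (\<alpha> + \<beta>) =
        (\<Sum>l=1..n. Poly_Mapping.lookup (f l * partial_deriv l ?p) (\<alpha> + \<beta>))"
      by (simp add: diff_op_def lookup_sum)
    also have "\<dots> = (\<Sum>l=1..n. if l = i then Poly_Mapping.lookup (f i * partial_deriv i ?p) (\<alpha> + \<beta>) else 0)"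
    proof (rule sum.cong)
      fix l assume l: "l \<in> {1..n}"
      have "Poly_Mapping.lookup (f l * partial_deriv l ?p) (\<alpha> + \<beta>) = 0" if "l > i"
      proof (rule ccontr)
        assume "Poly_Mapping.lookup (f l * partial_deriv l ?p) (\<alpha> + \<beta>) \<noteq> 0"
        then have "\<alpha> + \<beta> \<in> Poly_Mapping.keys (f l * partial_deriv l ?p)"
          by (simp add: in_keys_iff)
        then obtain \<mu> \<delta> where \<mu>: "\<alpha> + \<beta> = \<mu> + \<delta>" "\<mu> \<in> Poly_Mapping.keys (f l)"
          and "\<delta> \<in> Poly_Mapping.keys (partial_deriv l ?p)"
          using keys_mult[of "f l" "partial_deriv l ?p"] by blast
        then have "\<delta> + Poly_Mapping.single l 1 = ?\<gamma>"
          using keys_partial_deriv[of \<delta> l ?p] by (simp add: xpow_def)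
        from arg_cong[OF this, of "\<lambda>\<delta>. Poly_Mapping.lookup \<delta> l"]
        have "Poly_Mapping.lookup \<delta> l + 1 = Poly_Mapping.lookup \<beta> l"
          using that by (simp add: lookup_add lookup_single)
        moreover have "Poly_Mapping.lookup \<alpha> l + Poly_Mapping.lookup \<beta> l =
            Poly_Mapping.lookup \<mu> l + Poly_Mapping.lookup \<delta> l"
          using \<mu>(1) by (metis lookup_add)
        ultimately show False
          using low[OF \<alpha> i(1), of l] low[OF \<mu>(2) l, of l] that by simp
      qed
      then show "Poly_Mapping.lookup (f l * partial_deriv l ?p) (\<alpha> + \<beta>) =
          (if l = i then Poly_Mapping.lookup (f i * partial_deriv i ?p) (\<alpha> + \<beta>) else 0)"
        using least[OF l] by (cases l i rule: linorder_cases) auto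
    qed simp
    also have "\<dots> = Poly_Mapping.lookup (f i * partial_deriv i ?p) (\<alpha> + \<beta>)"
      using i(1) by simp
    also have "partial_deriv i ?p =
        Poly_Mapping.single \<beta> (of_nat (Suc (Poly_Mapping.lookup \<beta> i)) :: 'k)"
      by (simp add: partial_deriv_xpow lookup_add)
    also have "Poly_Mapping.lookup (f i * Poly_Mapping.single \<beta> (of_nat (Suc (Poly_Mapping.lookup \<beta> i)))) (\<alpha> + \<beta>) =
        of_nat (Suc (Poly_Mapping.lookup \<beta> i)) * Poly_Mapping.lookup (f i) \<alpha>"
      by (metis add.commute lookup_single_mult mult.commute)
    also have "\<dots> \<noteq> 0"
      using \<alpha> by (simp add: in_keys_iff del: of_nat_Suc)
    finally show thesis
    proof (rule result[OF j, rotated])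
      show "Poly_Mapping.keys ?\<gamma> \<subseteq> {1..j - 1}"
        using keys_add[of \<beta> "Poly_Mapping.single i 1"] basis_indexD(1)[OF \<beta>j] i by fastforce
    qed (simp add: lookup_add)
  next
    case False
    obtain \<alpha> i where \<alpha>: "(\<alpha>, i) \<in> support n f" "(\<alpha>, i) \<notin> under (index_order n) z"
      using not_sub by auto
    then have \<alpha>i: "(\<alpha>, i) \<in> basis_index n" and key: "\<alpha> \<in> Poly_Mapping.keys (f i)"
      using f by (auto simp: support_def)
    have not_le: "((\<alpha>, i), z) \<notin> index_order n"
      using \<alpha>(2) by (simp add: under_def)
    moreover have "(z, z) \<in> index_order n"
      using z by (auto simp: index_order_def)
    ultimately have "(\<alpha>, i) \<noteq> z"
      by auto
    moreover from this have "(z, (\<alpha>, i)) \<in> index_order n"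
      using Well_orderD(4)[OF Well_order_index_order[of n]] not_le \<alpha>i z
      unfolding total_on_def Field_index_order by blast
    moreover have "\<not> i < j"
      using False key basis_indexD(2)[OF \<alpha>i] by auto
    ultimately have "i = j" "antilex \<beta> \<alpha>"
      unfolding zz using index_order_iff[OF \<alpha>i \<beta>j] by auto
    then obtain m where m: "Poly_Mapping.lookup \<beta> m < Poly_Mapping.lookup \<alpha> m"
      "\<And>k. k > m \<Longrightarrow> Poly_Mapping.lookup \<beta> k = Poly_Mapping.lookup \<alpha> k"
      unfolding antilex_def by blast
    have mj: "m \<in> {1..j - 1}"
      using m(1) lookup_eq_0_if_keys[OF basis_indexD(1)[OF \<alpha>i], of m] \<open>i = j\<close> by fastforce
    \<comment> \<open>Lowering position \<open>m\<close> leaves it at least \<open>\<beta>\<^sub>m\<close>; the positions before \<open>m\<close>, where \<open>\<alpha>\<close> may be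
        smaller than \<open>\<beta>\<close>, are made up for by multiplying with the initial part \<open>\<gamma>\<close> of \<open>\<beta>\<close>.\<close>
    let ?\<gamma> = "Abs_poly_mapping (\<lambda>k. if k < m then Poly_Mapping.lookup \<beta> k else 0)"
    let ?\<delta> = "\<alpha> - Poly_Mapping.single m 1"
    let ?g = "\<lambda>k. if k = m then xpow ?\<gamma> else 0 :: 'k mpoly"
    have \<gamma>: "Poly_Mapping.lookup ?\<gamma> = (\<lambda>k. if k < m then Poly_Mapping.lookup \<beta> k else 0)"
      by (rule lookup_Abs_poly_mapping)
        (rule finite_subset[OF _ finite_lookup[of \<beta>]], auto)
    have \<delta>: "?\<delta> + Poly_Mapping.single m 1 = \<alpha>"
      using m(1) by (intro poly_mapping_eqI) (auto simp: lookup_add lookup_minus lookup_single when_def)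
    have mn: "m \<in> {1..n}" "m \<noteq> j"
      using mj j by auto
    have "bracket n f ?g j = - (Poly_Mapping.single ?\<gamma> 1 * partial_deriv m (f j))"
      using mn by (simp add: bracket_def diff_op_monomial xpow_def)
    then have "Poly_Mapping.lookup (bracket n f ?g j) (?\<gamma> + ?\<delta>) =
        - Poly_Mapping.lookup (partial_deriv m (f j)) ?\<delta>"
      by (simp only: lookup_uminus lookup_single_mult mult_1)
    also have "Poly_Mapping.lookup (partial_deriv m (f j)) ?\<delta> =
        of_nat (Suc (Poly_Mapping.lookup ?\<delta> m)) * Poly_Mapping.lookup (f j) \<alpha>"
      unfolding lookup_partial_deriv \<delta> ..
    finally have "Poly_Mapping.lookup (bracket n f ?g j) (?\<gamma> + ?\<delta>) \<noteq> 0"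
      using key \<open>i = j\<close> by (simp add: in_keys_iff del: of_nat_Suc)
    then show thesis
    proof (rule result[OF mn(1), rotated])
      show "Poly_Mapping.keys ?\<gamma> \<subseteq> {1..m - 1}"
      proof
        fix k assume "k \<in> Poly_Mapping.keys ?\<gamma>"
        then have "k < m" "k \<in> Poly_Mapping.keys \<beta>"
          by (auto simp: in_keys_iff \<gamma> split: if_splits)
        then show "k \<in> {1..m - 1}"
          using subsetD[OF basis_indexD(1)[OF \<beta>j], of k] by auto
      qed
      show "Poly_Mapping.lookup \<beta> l \<le> Poly_Mapping.lookup (?\<gamma> + ?\<delta>) l" for l
        using m(1) m(2)[of l]
        by (cases l m rule: linorder_cases) (auto simp: lookup_add lookup_minus lookup_single \<gamma>)
    qed
  qed
qed

lemma tri_mult_closed: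
  assumes "D \<in> carrier (tri n)" "E \<in> carrier (tri n)"
  shows "D \<otimes>\<^bsub>tri n\<^esub> E \<in> carrier (tri n)"
proof -
  obtain f g where "D = tri_der n f" "E = tri_der n g" "support n f \<subseteq> basis_index n" "support n g \<subseteq> basis_index n"
    using assms unfolding carrier_tri by (metis supportedE)
  then show ?thesis
    using support_bracket(1)[of n f g] by (auto simp: carrier_tri mult_tri tri_der_supported_iff)
qed

lemma diff_op_add_coeffs: "diff_op n (\<lambda>i. f i + g i) p = diff_op n f p + diff_op n g p"
  by (simp add: diff_op_def distrib_right sum.distrib)

lemma tri_mult_distrib:
  assumes "D \<in> carrier (tri n)" "E \<in> carrier (tri n)" "F \<in> carrier (tri n)"
  shows "(D \<oplus>\<^bsub>tri n\<^esub> E) \<otimes>\<^bsub>tri n\<^esub> F = D \<otimes>\<^bsub>tri n\<^esub> F \<oplus>\<^bsub>tri n\<^esub> E \<otimes>\<^bsub>tri n\<^esub> F"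
    and "D \<otimes>\<^bsub>tri n\<^esub> (E \<oplus>\<^bsub>tri n\<^esub> F) = D \<otimes>\<^bsub>tri n\<^esub> E \<oplus>\<^bsub>tri n\<^esub> D \<otimes>\<^bsub>tri n\<^esub> F"
proof -
  obtain f g h where [simp]: "D = tri_der n f" "E = tri_der n g" "F = tri_der n h"
    and s: "support n f \<subseteq> basis_index n" "support n g \<subseteq> basis_index n" "support n h \<subseteq> basis_index n"
    using assms unfolding carrier_tri by (metis supportedE)
  have s': "support n (\<lambda>i. f i + g i) \<subseteq> basis_index n" "support n (\<lambda>i. g i + h i) \<subseteq> basis_index n"
    using s support_add[of n f g] support_add[of n g h] by blast+
  show "(D \<oplus>\<^bsub>tri n\<^esub> E) \<otimes>\<^bsub>tri n\<^esub> F = D \<otimes>\<^bsub>tri n\<^esub> F \<oplus>\<^bsub>tri n\<^esub> E \<otimes>\<^bsub>tri n\<^esub> F"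
    "D \<otimes>\<^bsub>tri n\<^esub> (E \<oplus>\<^bsub>tri n\<^esub> F) = D \<otimes>\<^bsub>tri n\<^esub> E \<oplus>\<^bsub>tri n\<^esub> D \<otimes>\<^bsub>tri n\<^esub> F"
    by (simp_all add: add_tri mult_tri s s' tri_der_eq_iff bracket_def diff_op_add diff_op_add_coeffs)
qed

text \<open>
  The successor step of the central series. An element of the span of the \<open>Y \<le> Z\<close> is central modulo
  the span of the \<open>Y < Z\<close> since brackets strictly lower its monomials; an element with a monomial
  that is not \<open>\<le> Z\<close> is not central, by \<open>exists_bracket_not_below\<close>.
\<close>

lemma centre_preimage_supported_underS:
  fixes z :: "(nat \<Rightarrow>\<^sub>0 nat) \<times> nat"
  assumes z: "z \<in> basis_index n"
  shows "centre_preimage (tri n) (supported n (underS (index_order n) z) :: ('k::field_char_0 mpoly \<Rightarrow> 'k mpoly) set) =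
    supported n (under (index_order n) z)"
    (is "centre_preimage ?L ?I = _")
proof -
  note wo = Well_orderD[OF Well_order_index_order[of n]]
  have sub: "underS (index_order n) z \<subseteq> basis_index n" "under (index_order n) z \<subseteq> basis_index n"
    by (auto simp: underS_def under_def index_order_def)
  have down: "w \<in> underS (index_order n) z" if "w \<in> underS (index_order n) y" "y \<in> under (index_order n) z" for w y
    using that transD[OF wo(2), of w y z] antisymD[OF wo(3), of w y] unfolding underS_def under_def by blast
  have S: "underS (index_order n) z \<subseteq> under (index_order n) z"
    by (auto simp: underS_def under_def)
  have bracket_I: "tri_der n f \<otimes>\<^bsub>?L\<^esub> tri_der n g \<in> ?I"
    if f: "support n f \<subseteq> basis_index n" and g: "support n g \<subseteq> basis_index n"
      and "support n f \<subseteq> under (index_order n) z \<or> support n g \<subseteq> under (index_order n) z" for f g :: "nat \<Rightarrow> 'k mpoly"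
  proof -
    have "support n (bracket n f g) \<subseteq> underS (index_order n) z"
      using support_bracket(2,3)[OF f g] down that(3) by blast
    then show ?thesis
      by (simp add: mult_tri f g tri_der_supported_iff)
  qed
  have mult_I: "D \<otimes>\<^bsub>?L\<^esub> E \<in> ?I"
    if D: "D \<in> carrier ?L" and E: "E \<in> carrier ?L"
      and DE: "D \<in> supported n (under (index_order n) z) \<or> E \<in> supported n (under (index_order n) z)" for D E
  proof -
    obtain f g where "D = tri_der n f" "E = tri_der n g"
      "support n f \<subseteq> basis_index n" "support n g \<subseteq> basis_index n"
      using D E unfolding carrier_tri by (metis supportedE)
    then show ?thesis
      using DE bracket_I by (auto simp: tri_der_supported_iff)
  qed
  have I: "D \<in> carrier ?L \<and> D \<in> supported n (under (index_order n) z)" if "D \<in> ?I" for D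
    using that supported_mono[OF sub(1)] supported_mono[OF S] unfolding carrier_tri by blast
  have "centre_preimage ?L ?I = {D \<in> carrier ?L. \<forall>E\<in>carrier ?L. D \<otimes>\<^bsub>?L\<^esub> E \<in> ?I}"
    using mult_I I
    by (intro centre_preimage_eq abelian_group_tri additive_subgroup_supported sub tri_mult_closed tri_mult_distrib)
      blast+
  also have "\<dots> = supported n (under (index_order n) z)"
  proof (intro equalityI subsetI)
    fix D assume "D \<in> {D \<in> carrier ?L. \<forall>E\<in>carrier ?L. D \<otimes>\<^bsub>?L\<^esub> E \<in> ?I}"
    then have D: "D \<in> carrier ?L" "\<And>E. E \<in> carrier ?L \<Longrightarrow> D \<otimes>\<^bsub>?L\<^esub> E \<in> ?I" by auto
    obtain f where f: "D = tri_der n f" "support n f \<subseteq> basis_index n"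
      using D(1) unfolding carrier_tri by (rule supportedE)
    have "support n f \<subseteq> under (index_order n) z"
    proof (rule ccontr)
      assume "\<not> support n f \<subseteq> under (index_order n) z"
      then obtain g where g: "support n g \<subseteq> basis_index n"
        "\<not> support n (bracket n f g) \<subseteq> underS (index_order n) z"
        using exists_bracket_not_below[OF f(2) z] by blast
      then show False
        using D(2)[of "tri_der n g"] by (simp add: f carrier_tri mult_tri tri_der_supported_iff)
    qed
    then show "D \<in> supported n (under (index_order n) z)"
      by (simp add: f(1) tri_der_supported_iff)
  next
    fix D :: "'k mpoly \<Rightarrow> 'k mpoly" assume "D \<in> supported n (under (index_order n) z)"
    then show "D \<in> {D \<in> carrier ?L. \<forall>E\<in>carrier ?L. D \<otimes>\<^bsub>?L\<^esub> E \<in> ?I}"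
      using mult_I supported_mono[OF sub(2)] unfolding carrier_tri by blast
  qed
  finally show ?thesis .
qed

section \<open>The central series of the triangular derivations\<close>

lemma basis_order_eq: "basis_order n = dir_image (index_order n) (\<lambda>(\<alpha>, i). basis_elt n \<alpha> i)"
  unfolding basis_order_def dir_image_def index_order_def tri_basis_def by fastforce

lemma tri_basis_eq: "tri_basis n = (\<lambda>(\<alpha>, i). basis_elt n \<alpha> i) ` basis_index n"
  unfolding tri_basis_def by force

lemma ordtype_cong: "r =o s \<Longrightarrow> ordtype r = ordtype s"
  unfolding ordtype_def by (metis ordIso_symmetric ordIso_transitive)

lemma not_less_ordinal_0: "\<not> (a :: 'b ordinal) < 0"
proof
  assume "a < 0"
  then have "rep_ordinal a <o ({} :: 'b rel)"
    unfolding less_ordinal_def using rep_ordinal_0 ordLess_ordIso_trans by blast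
  then show False
    using ordLess_iff_ordIso_Restr[of "{} :: 'b rel" "rep_ordinal a"] rep_ordinal_Well_order by auto
qed

text \<open>
  Bounds the union of the whole series, over all ordinals, without computing the terms beyond the
  order type of the basis.
\<close>

lemma central_series_subset_carrier:
  assumes "\<zero>\<^bsub>L\<^esub> \<in> carrier L"
  shows "central_series L a \<subseteq> carrier L"
proof (induction a rule: less_induct)
  case (less a)
  show ?case
  proof (cases "\<exists>b. is_succ_of a b")
    case True
    then show ?thesis
      using assms by (subst central_series.simps) (auto simp: centre_preimage_def)
  next
    case False
    then show ?thesis
      using assms less by (subst central_series.simps) auto
  qed
qed

lemma supported_empty: "supported n {} = {\<zero>\<^bsub>tri n\<^esub> :: 'k::field mpoly \<Rightarrow> 'k mpoly}"
proof (intro equalityI subsetI)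
  fix D :: "'k mpoly \<Rightarrow> 'k mpoly" assume "D \<in> supported n {}"
  then obtain f where f: "D = tri_der n f" "support n f \<subseteq> {}"
    by (rule supportedE)
  then have "\<forall>i\<in>{1..n}. f i = 0"
    unfolding support_def using keys_eq_empty by fastforce
  then show "D \<in> {\<zero>\<^bsub>tri n\<^esub>}"
    by (simp add: f(1) zero_tri tri_der_eq_iff)
qed (simp add: supported_zero)

text \<open>
  Moves the computation of \<open>ord(X)\<close> from basis elements to their indices.
\<close>

lemma Restr_dir_image_below:
  assumes inj: "inj_on f (Field r)" and z: "z \<in> Field r"
  shows "Restr (dir_image r f) {y. (y, f z) \<in> dir_image r f} = dir_image (Restr r (under r z)) f"
proof -
  have iff: "(f x, f y) \<in> dir_image r f \<longleftrightarrow> (x, y) \<in> r" if "x \<in> Field r" "y \<in> Field r" for x y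
  proof
    assume "(f x, f y) \<in> dir_image r f"
    then obtain u v where "f x = f u" "f y = f v" "(u, v) \<in> r"
      unfolding dir_image_def by blast
    moreover from this have "x = u" "y = v"
      using inj that by (metis FieldI1 FieldI2 inj_onD)+
    ultimately show "(x, y) \<in> r" by simp
  qed (auto simp: dir_image_def)
  have "{y. (y, f z) \<in> dir_image r f} = f ` under r z"
  proof (intro equalityI subsetI)
    fix y assume "y \<in> {y. (y, f z) \<in> dir_image r f}"
    then have y: "(y, f z) \<in> dir_image r f" by simp
    then obtain x where x: "x \<in> Field r" "y = f x"
      unfolding dir_image_def by (blast intro: FieldI1)
    then show "y \<in> f ` under r z"
      using y iff[OF x(1) z] by (simp add: under_def)
  qed (auto simp: dir_image_def under_def)
  moreover have "Restr (dir_image r f) (f ` under r z) = dir_image (Restr r (under r z)) f"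
  proof (intro equalityI subsetI)
    fix p assume "p \<in> Restr (dir_image r f) (f ` under r z)"
    then obtain x y where "x \<in> under r z" "y \<in> under r z" "p = (f x, f y)" "p \<in> dir_image r f"
      by blast
    moreover from this have "x \<in> Field r" "y \<in> Field r"
      by (auto simp: under_def intro: FieldI1)
    ultimately show "p \<in> dir_image (Restr r (under r z)) f"
      using iff unfolding dir_image_def by blast
  qed (auto simp: dir_image_def)
  ultimately show ?thesis by simp
qed

lemma basis_ord_basis_elt:
  assumes z: "z \<in> basis_index n"
  shows "basis_ord n ((\<lambda>(\<alpha>, i). basis_elt n \<alpha> i :: 'k::field mpoly \<Rightarrow> 'k mpoly) z) =
    ordtype (Restr (index_order n) (under (index_order n) z))"
proof -
  define b where "b = (\<lambda>(\<alpha>, i). basis_elt n \<alpha> i :: 'k mpoly \<Rightarrow> 'k mpoly)"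
  let ?R = "Restr (index_order n) (under (index_order n) z)"
  have order: "basis_order n = dir_image (index_order n) b"
    unfolding b_def by (rule basis_order_eq)
  have inj: "inj_on b (Field (index_order n))"
    unfolding Field_index_order b_def by (rule inj_on_basis_elt)
  have "?R =o dir_image ?R b"
  proof (rule dir_image_ordIso)
    show "inj_on b (Field ?R)"
      by (rule inj_on_subset[OF inj]) (auto simp: Field_def)
  qed (rule Well_order_Restr[OF Well_order_index_order])
  then have "ordtype (dir_image ?R b) = ordtype ?R"
    by (metis ordtype_cong)
  moreover have "z \<in> Field (index_order n)"
    using z by (simp add: Field_index_order)
  ultimately show ?thesis
    using Restr_dir_image_below[OF inj] unfolding basis_ord_def order b_def[symmetric] by metis
qed

theorem theorem3p6:
  fixes n :: nat
    and L :: "'k::field_char_0 lie_der"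
  assumes "n \<ge> 2"
    and "L = tri n"
  shows "c_dim L = (omega_sum n :: 'b::infinite ordinal)
    \<and> (\<forall>a :: 'b ordinal. 1 \<le> a \<and> a \<le> omega_sum n \<longrightarrow> central_series L a = tri_ideal n a)
    \<and> central_series L (c_dim L :: 'b ordinal) = carrier L"
proof -
  interpret well_order_of_type "index_order n" "omega_sum n :: 'b ordinal"
    by unfold_locales (rule omega_sum_index_order)
  define J :: "'b ordinal \<Rightarrow> _" where "J a = {z \<in> basis_index n. pos z \<le> a}" for a
  have pos_succ: "\<exists>b. is_succ_of (pos z) b" if "z \<in> basis_index n" for z
    using pos_is_succ[of z] that unfolding Field_index_order by blast
  have ideal: "tri_ideal n a = (supported n (J a) :: ('k mpoly \<Rightarrow> 'k mpoly) set)" for a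
  proof -
    let ?b = "\<lambda>(\<alpha>, i). basis_elt n \<alpha> i :: 'k mpoly \<Rightarrow> 'k mpoly"
    have "basis_ord n (?b z) = pos z" if "z \<in> basis_index n" for z
      unfolding pos_def by (rule basis_ord_basis_elt[OF that])
    then have "J a = {z \<in> basis_index n. basis_ord n (?b z) \<le> a}"
      unfolding J_def by (intro Collect_cong conj_cong) simp_all
    then have "{X \<in> tri_basis n. basis_ord n X \<le> a} = ?b ` J a"
      unfolding tri_basis_eq by blast
    then show ?thesis
      unfolding tri_ideal_def using lin_span_basis[of "J a" n] by (simp add: J_def)
  qed
  have series: "central_series L a = supported n (J a)" if "a \<le> omega_sum n" for a
    using that
  proof (induction a rule: less_induct)
    case (less a)
    consider "a = 0" | b where "is_succ_of a b" | "a \<noteq> 0" "\<nexists>b. is_succ_of a b" by blast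
    then show ?case
    proof cases
      case 1
      have "\<not> pos z \<le> 0" if "z \<in> basis_index n" for z
        using pos_succ[OF that] not_less_ordinal_0 unfolding is_succ_of_def
        by (meson order.strict_trans2)
      then have "J a = {}"
        unfolding 1 J_def by blast
      then show ?thesis
        unfolding 1 assms(2) by (subst central_series.simps) (simp add: supported_empty)
    next
      case (2 b)
      then have b: "b < a" and b_max: "\<And>c. c < a \<Longrightarrow> c \<le> b"
        by (auto simp: is_succ_of_def)
      then have "b < omega_sum n"
        using less.prems by simp
      then obtain z where z: "z \<in> basis_index n" "is_succ_of (pos z) b"
        using is_succ_of_pos unfolding Field_index_order by blast
      \<comment> \<open>\<open>Z\<close> is the only basis element that enters at step \<open>a\<close>.\<close>
      have "pos z = a"
        using z(2) b b_max unfolding is_succ_of_def by (metis linorder_neqE not_le)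
      have iff: "y \<in> underS z \<longleftrightarrow> pos y < a" if "y \<in> basis_index n" for y
        using pos_less_iff[of y z] that z(1) \<open>pos z = a\<close> unfolding Field_index_order underS_def by auto
      have sub: "underS z \<subseteq> basis_index n"
        by (auto simp: underS_def index_order_def)
      have under: "under z = insert z (underS z)"
        using z(1) REFL by (auto simp: under_def underS_def refl_on_def Field_index_order)
      have eq: "y = z" if "y \<in> basis_index n" "pos y = a" for y
      proof (rule ccontr)
        assume "y \<noteq> z"
        moreover have F: "y \<in> Field (index_order n)" "z \<in> Field (index_order n)"
          using that(1) z(1) by (simp_all add: Field_index_order)
        ultimately have "pos y < pos z \<or> pos z < pos y"
          using TOTALS pos_less_iff[OF F] pos_less_iff[OF F(2,1)] by blast
        then show False
          using that(2) \<open>pos z = a\<close> by simp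
      qed
      have "c \<le> b \<longleftrightarrow> c < a" for c
        using b b_max by (meson order.strict_trans1)
      then have "J b = underS z"
        using iff sub unfolding J_def by blast
      moreover have "J a = under z"
        using iff sub eq z(1) \<open>pos z = a\<close> unfolding J_def under le_less by blast
      moreover have "a \<noteq> 0"
        using b not_less_ordinal_0 by blast
      moreover have "central_series L a = centre_preimage L (central_series L b)"
        using \<open>a \<noteq> 0\<close> 2 by (subst central_series.simps) (auto simp: the_is_succ_of)
      moreover have "central_series L b = supported n (J b)"
        using less.IH[OF b] b less.prems by simp
      ultimately show ?thesis
        using centre_preimage_supported_underS[OF z(1)] assms(2) by metis
    next
      case 3
      have lt: "pos z < a" if "z \<in> J a" for z
        using that pos_succ[of z] 3(2) unfolding J_def le_less by blast
      have "0 < a"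
        using 3(1) not_less_ordinal_0[of a] by (meson linorder_neqE)
      have "central_series L a = (\<Union>b<a. supported n (J b))"
        using 3 less by (subst central_series.simps) auto
      also have "(\<Union>b<a. supported n (J b)) = (supported n (J a) :: ('k mpoly \<Rightarrow> 'k mpoly) set)"
        (is "?U = ?V")
      proof
        show "?U \<subseteq> ?V"
          by (intro UN_least supported_mono) (auto simp: J_def)
        show "?V \<subseteq> ?U"
        proof
          fix D :: "'k mpoly \<Rightarrow> 'k mpoly" assume "D \<in> supported n (J a)"
          then obtain f where f: "D = tri_der n f" "support n f \<subseteq> J a"
            by (rule supportedE)
          \<comment> \<open>The \<open>0\<close> only serves to make the set nonempty when \<open>f\<close> vanishes.\<close>
          let ?S = "insert 0 (pos ` support n f)"
          have "Max ?S < a"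
            using f(2) lt \<open>0 < a\<close> finite_support[of n f] by auto
          moreover have "support n f \<subseteq> J (Max ?S)"
            using f(2) finite_support[of n f] by (auto simp: J_def intro!: Max_ge)
          ultimately show "D \<in> ?U"
            unfolding f(1) by (auto simp: tri_der_supported_iff)
        qed
      qed
      finally show ?thesis .
    qed
  qed
  have top: "central_series L (omega_sum n :: 'b ordinal) = carrier L"
  proof -
    have "J (omega_sum n) = basis_index n"
      using pos_le by (auto simp: J_def)
    then show ?thesis
      using series[of "omega_sum n"] by (simp add: carrier_tri assms(2))
  qed
  have union: "(\<Union>b :: 'b ordinal. central_series L b) = carrier L"
  proof -
    have "\<zero>\<^bsub>L\<^esub> \<in> carrier L"
      unfolding assms(2) carrier_tri by (rule supported_zero)
    then show ?thesis
      using central_series_subset_carrier top by blast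
  qed
  have dim: "c_dim L = (omega_sum n :: 'b ordinal)"
    unfolding c_dim_def union
  proof (rule Least_equality)
    fix a :: "'b ordinal" assume a: "central_series L a = carrier L"
    show "omega_sum n \<le> a"
    proof (rule ccontr)
      assume "\<not> omega_sum n \<le> a"
      then have "a < omega_sum n" by simp
      then obtain z where z: "z \<in> basis_index n" "is_succ_of (pos z) a"
        using is_succ_of_pos unfolding Field_index_order by blast
      define f :: "nat \<Rightarrow> 'k mpoly" where "f = (\<lambda>k. if k = snd z then xpow (fst z) else 0)"
      have "support n f = {z}"
        using basis_index_snd[OF z(1)] by (auto simp: f_def support_def xpow_def split: if_splits)
      moreover from this have "tri_der n f \<in> carrier L"
        unfolding assms(2) carrier_tri tri_der_supported_iff using z(1) by simp
      ultimately have "z \<in> J a"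
        using series[of a] \<open>a < omega_sum n\<close> a by (simp add: tri_der_supported_iff)
      then show False
        using z(2) by (auto simp: J_def is_succ_of_def)
    qed
  qed (rule top)
  show ?thesis
    using dim top series ideal by simp
qed

end
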